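(* Let $n_0$ be a nonnegative integer, let $n_1=3$ and $n=n_0+n_1$. Then for all nonnegative integers $a,b,k$, $$\operatorname{CT}_x\prod_{n_0+1\le i\ne j\le n}\left(1-\frac{x_i}{x_j}\right)\cdot\prod_{l=1}^n\left(1-\frac{x_l}{x_0}\right)^{a}\left(1-\frac{x_0}{x_l}\right)^{b}\prod_{1\le i\ne j\le n}\left(1-\frac{x_i}{x_j}\right)^{k}$$ $$=M_{n_0}(a,b,k)\prod_{j=0}^{n_1-1}\frac{(j+1)\,((k+1)j+a+b+kn_0)!\,(kj+k+j+kn_0)!}{k!\,((k+1)j+a+kn_0)!\,((k+1)j+b+kn_0)!}.$$
   Context: $\operatorname{CT}_x$ denotes the constant term (the coefficient of $x_0^0x_1^0\cdots x_n^0$) of a Laurent polynomial in $x_0,\ldots,x_n$. Products over $i\neq j$ are over ordered pairs. For $n_0\ge 0$, $$M_{n_0}(a,b,k):=\prod_{l=0}^{n_0-1}\frac{(a+b+kl)!\,(k(l+1))!}{(a+kl)!\,(b+kl)!\,k!},$$ with the empty product equal to $1$. *)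

theory Defs
  imports Complex_Main "HOL-Library.Poly_Mapping"
begin

text \<open>
  Laurent polynomials over the rationals in variables indexed by the natural numbers, as
  the group algebra of the free abelian group of finitely supported exponent vectors;
  multiplication of polynomial mappings is convolution. Only finitely many variables occur
  in any one element, so fixing their number in the type is not necessary.
\<close>

type_synonym laurent = "(nat \<Rightarrow>\<^sub>0 int) \<Rightarrow>\<^sub>0 rat"

definition var_ratio :: "nat \<Rightarrow> nat \<Rightarrow> laurent"  \<comment> \<open>the monomial \<open>x\<^sub>i x\<^sub>j\<^sup>-\<^sup>1\<close>\<close>
  where "var_ratio i j =
    Poly_Mapping.single (Poly_Mapping.single i 1 - Poly_Mapping.single j 1) 1"

definition CT :: "laurent \<Rightarrow> rat"
  where "CT p = Poly_Mapping.lookup p 0"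

definition offdiag :: "nat set \<Rightarrow> (nat \<times> nat) set"
  where "offdiag S = {(i, j). i \<in> S \<and> j \<in> S \<and> i \<noteq> j}"

definition M :: "nat \<Rightarrow> nat \<Rightarrow> nat \<Rightarrow> nat \<Rightarrow> rat"
  where "M n\<^sub>0 a b k =
    (\<Prod>l<n\<^sub>0. fact (a + b + k * l) * fact (k * (l + 1))
             / (fact (a + k * l) * fact (b + k * l) * fact k))"

end

theory Submission
  imports Defs "HOL-Combinatorics.Transposition"
begin

text \<open>
  Write \<open>y\<^sub>l = x\<^sub>l / x\<^sub>0\<close>. The product without the extra factors \<open>1 - x\<^sub>i / x\<^sub>j\<close> of the last
  three variables, the heavy ones, is the weight of Morris' constant term identity, and it is symmetric in
  \<open>x\<^sub>1, \<dots>, x\<^sub>n\<close>. The extra factors expand into finitely many monomials in three variables, so the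
  constant term in question is a combination of moments, that is, of constant terms of the weight
  times a monomial. By symmetry it equals
  \<open>6 ([0,0,0] - 2 [1,-1,0] + [1,1,-2] + [2,-1,-1] - [2,-2,0])\<close>, where \<open>[p,q,r]\<close> is the moment of
  \<open>y\<^sub>1\<^sup>p y\<^sub>2\<^sup>q y\<^sub>3\<^sup>r\<close>.

  The moments obey linear relations in the style of Aomoto. The Euler operator \<open>x\<^sub>i \<partial>/\<partial>x\<^sub>i\<close> kills
  constant terms, so applying it to \<open>(y\<^sub>i - 1) g\<close> times the weight and taking constant terms gives a
  relation for every Laurent polynomial \<open>g\<close>. The factor \<open>y\<^sub>i - 1\<close> clears the pole that the
  logarithmic derivative of the weight has at \<open>y\<^sub>i = 1\<close>. The poles of that derivative at
  \<open>y\<^sub>i = y\<^sub>j\<close> disappear after averaging over the exchange of \<open>x\<^sub>i\<close> and \<open>x\<^sub>j\<close>, which replaces a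
  polynomial by its divided difference
  (\<open>integration_by_parts\<close>, \<open>pair_moment_divided_difference\<close>).

  For \<open>g\<close> a squarefree product of the \<open>y\<^sub>l\<close> the relation has only two terms (\<open>aomoto_recursion\<close>).
  Iterating it over all variables compares the exponents \<open>(a + 1, b)\<close> and \<open>(a, b + 1)\<close>, which reduces
  Morris' identity to \<open>b = 0\<close>; there \<open>a\<close> does not influence the constant term, and for
  \<open>a = b = 0\<close> exchanging \<open>x\<^sub>0\<close> with one of the \<open>x\<^sub>l\<close> leads to one variable fewer with \<open>a = b = k\<close>.
  This proves \<open>morris_constant_term\<close> by induction and evaluates \<open>[0,0,0]\<close>.

  For the other moments, eight relations form a triangular system once the eight relations obtained from
  \<open>x\<^sub>l \<mapsto> x\<^sub>l\<^sup>-\<^sup>1\<close>, which exchanges \<open>a\<close> and \<open>b\<close>, are added (\<open>mom_relations\<close>). Solving it writes each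
  moment as \<open>[0,0,0]\<close> times an explicit rational function, and the combination above then factors
  completely (\<open>heavy_triple_average\<close>).
\<close>

section \<open>Constant terms, Euler operators and monomial substitutions\<close>

lemma sum_of_terms:
  fixes p :: laurent
  shows "(\<Sum>e\<in>Poly_Mapping.keys p. Poly_Mapping.single e (Poly_Mapping.lookup p e)) = p"
proof (rule poly_mapping_eqI)
  fix e
  show "Poly_Mapping.lookup (\<Sum>e\<in>Poly_Mapping.keys p.
      Poly_Mapping.single e (Poly_Mapping.lookup p e)) e = Poly_Mapping.lookup p e"
    by (simp add: lookup_sum lookup_single when_def sum.delta in_keys_iff)
qed

lemma laurent_induct [case_names zero single add]:
  fixes p :: laurent
  assumes "P 0" and "\<And>e c. P (Poly_Mapping.single e c)"
    and "\<And>p q. P p \<Longrightarrow> P q \<Longrightarrow> P (p + q)"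
  shows "P p"
proof -
  have "P (\<Sum>e\<in>A. Poly_Mapping.single e (Poly_Mapping.lookup p e))" if "finite A" for A
    using that by induction (auto intro: assms)
  from this[of "Poly_Mapping.keys p"] show ?thesis
    by (simp add: sum_of_terms)
qed

lemma CT_add: "CT (p + q) = CT p + CT q"
  and CT_diff: "CT (p - q) = CT p - CT q"
  and CT_uminus: "CT (- p) = - CT p"
  and CT_zero [simp]: "CT 0 = 0"
  and CT_one [simp]: "CT 1 = 1"
  and CT_sum: "CT (sum f A) = (\<Sum>x\<in>A. CT (f x))"
  by (simp_all add: CT_def lookup_add lookup_minus lookup_sum)

lemma CT_const_mult: "CT (Poly_Mapping.single 0 c * p) = c * CT p"
  by (induction p rule: laurent_induct)
     (auto simp: CT_def mult_single lookup_single lookup_add distrib_left when_def)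

lemma CT_of_nat_mult: "CT (of_nat m * p) = of_nat m * CT p"
  and CT_of_int_mult: "CT (of_int z * p) = of_int z * CT p"
  using CT_const_mult[of "of_nat m" p] CT_const_mult[of "of_int z" p] by simp_all

lemma CT_numeral_mult: "CT (numeral m * p) = numeral m * CT p"
  using CT_const_mult[of "numeral m" p] by simp

text \<open>
  This is the operator \<open>x\<^sub>i \<partial>/\<partial>x\<^sub>i\<close>. It multiplies each term by its exponent of \<open>x\<^sub>i\<close>; hence it is a
  derivation, and its values have constant term \<open>0\<close>.
\<close>

definition euler :: "nat \<Rightarrow> laurent \<Rightarrow> laurent"
  where "euler i p = Poly_Mapping.mapp (\<lambda>e c. of_int (Poly_Mapping.lookup e i) * c) p"

lemma lookup_euler:
  "Poly_Mapping.lookup (euler i p) e = of_int (Poly_Mapping.lookup e i) * Poly_Mapping.lookup p e"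
  by (simp add: euler_def lookup_mapp when_def in_keys_iff)

lemma euler_add: "euler i (p + q) = euler i p + euler i q"
  and euler_diff: "euler i (p - q) = euler i p - euler i q"
  and euler_zero [simp]: "euler i 0 = 0"
  by (rule poly_mapping_eqI; simp add: lookup_euler lookup_add lookup_minus algebra_simps)+

lemma euler_term:
  "euler i (Poly_Mapping.single e c) = of_int (Poly_Mapping.lookup e i) * Poly_Mapping.single e c"
proof -
  have "euler i (Poly_Mapping.single e c)
      = Poly_Mapping.single 0 (of_int (Poly_Mapping.lookup e i)) * Poly_Mapping.single e c"
    unfolding mult_single
    by (rule poly_mapping_eqI) (simp add: lookup_euler lookup_single when_def)
  then show ?thesis by simp
qed

lemma euler_one [simp]: "euler i 1 = 0"
  using euler_term[of i 0 1] by simp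

lemma euler_numeral [simp]: "euler i (numeral w) = 0"
  using euler_term[of i 0 "numeral w"] by simp

lemma euler_mult: "euler i (p * q) = euler i p * q + p * euler i q"
proof (induction p rule: laurent_induct)
  case (single e c)
  show ?case
    by (induction q rule: laurent_induct)
       (simp_all add: euler_term mult_single lookup_add euler_add distrib_left distrib_right
          mult.assoc mult.left_commute[of "Poly_Mapping.single e c"])
qed (simp_all add: euler_add algebra_simps)

lemma CT_euler [simp]: "CT (euler i p) = 0"
  by (simp add: CT_def lookup_euler)

lemma euler_prod_eq_0:
  assumes "\<And>x. x \<in> A \<Longrightarrow> euler i (f x) = 0"
  shows "euler i (prod f A) = 0"
  using assms by (induction A rule: infinite_finite_induct) (simp_all add: euler_mult)

lemma euler_power: "euler i (p ^ m) = of_nat m * p ^ (m - 1) * euler i p"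
proof (induction m)
  case (Suc m)
  then show ?case
    by (cases m) (simp_all add: euler_mult algebra_simps)
qed simp

lemma euler_prod:
  assumes "finite A"
  shows "euler i (prod f A) = (\<Sum>x\<in>A. euler i (f x) * prod f (A - {x}))"
  using assms
proof induction
  case (insert x A)
  have "prod f (insert x A - {y}) = f x * prod f (A - {y})" if "y \<in> A" for y
    using that insert by (auto simp: insert_Diff_if)
  then show ?case
    using insert by (simp add: euler_mult sum_distrib_left algebra_simps)
qed simp

type_synonym expo = "nat \<Rightarrow>\<^sub>0 int"

text \<open>
  An additive involution of the exponents induces a ring automorphism that fixes constant terms.
  It is applied to two involutions: exchanging two variables expresses the symmetry of the weight,
  and negating all exponents exchanges the roles of \<open>a\<close> and \<open>b\<close>.
\<close>

locale monomial_map =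
  fixes \<phi> :: "expo \<Rightarrow> expo"
  assumes invol: "\<phi> (\<phi> e) = e" and additive: "\<phi> (e + f) = \<phi> e + \<phi> f"
begin

lemma inj: "inj \<phi>"
  by (metis injI invol)

definition subst :: "laurent \<Rightarrow> laurent" where "subst p = Poly_Mapping.map_key \<phi> p"

lemma lookup_subst: "Poly_Mapping.lookup (subst p) e = Poly_Mapping.lookup p (\<phi> e)"
  unfolding subst_def by (simp add: map_key.rep_eq inj)

lemma subst_term: "subst (Poly_Mapping.single e c) = Poly_Mapping.single (\<phi> e) c"
  by (rule poly_mapping_eqI) (auto simp: lookup_subst lookup_single when_def invol)

lemma subst_add: "subst (p + q) = subst p + subst q"
  and subst_diff: "subst (p - q) = subst p - subst q"
  and subst_zero [simp]: "subst 0 = 0"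
  by (rule poly_mapping_eqI; simp add: lookup_subst lookup_add lookup_minus)+

lemma map_zero [simp]: "\<phi> 0 = 0"
  using additive[of 0 0] by simp

lemma map_diff: "\<phi> (e - f) = \<phi> e - \<phi> f"
  using additive[of "e - f" f] by (simp add: algebra_simps)

lemma subst_one [simp]: "subst 1 = 1"
  using subst_term[of 0 1] by simp

lemma subst_mult: "subst (p * q) = subst p * subst q"
proof (induction p rule: laurent_induct)
  case (single e c)
  show ?case
    by (induction q rule: laurent_induct)
       (simp_all add: subst_term mult_single additive subst_add algebra_simps)
qed (simp_all add: subst_add algebra_simps)

lemma subst_power: "subst (p ^ m) = subst p ^ m"
  by (induction m) (simp_all add: subst_mult)

lemma subst_prod: "subst (prod f A) = (\<Prod>x\<in>A. subst (f x))"
  by (induction A rule: infinite_finite_induct) (simp_all add: subst_mult)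

lemma CT_subst [simp]: "CT (subst p) = CT p"
  by (simp add: CT_def lookup_subst)

end

interpretation inversion: monomial_map uminus
  by unfold_locales simp_all

definition swap_exponents :: "nat \<Rightarrow> nat \<Rightarrow> expo \<Rightarrow> expo"
  where "swap_exponents i j e = Poly_Mapping.map_key (Transposition.transpose i j) e"

lemma lookup_swap_exponents:
  "Poly_Mapping.lookup (swap_exponents i j e) l = Poly_Mapping.lookup e (Transposition.transpose i j l)"
  by (simp add: swap_exponents_def map_key.rep_eq)

interpretation swap: monomial_map "swap_exponents i j" for i j
  by unfold_locales
     (auto intro!: poly_mapping_eqI simp: lookup_swap_exponents lookup_add)

lemma swap_exponents_single:
  "swap_exponents i j (Poly_Mapping.single l c) = Poly_Mapping.single (Transposition.transpose i j l) c"
  by (rule poly_mapping_eqI) (auto simp: lookup_swap_exponents lookup_single when_def)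

lemma swap_var_ratio:
  "swap.subst i j (var_ratio l m) =
     var_ratio (Transposition.transpose i j l) (Transposition.transpose i j m)"
  by (simp add: var_ratio_def swap.subst_term swap.map_diff swap_exponents_single)

lemma inversion_var_ratio: "inversion.subst (var_ratio l m) = var_ratio m l"
  by (simp add: var_ratio_def inversion.subst_term)

lemma euler_var_ratio:
  "euler i (var_ratio l m) = of_int ((if i = l then 1 else 0) - (if i = m then 1 else 0)) * var_ratio l m"
  by (simp add: var_ratio_def euler_term lookup_minus lookup_single when_def)

text \<open>
  The power \<open>(x\<^sub>l / x\<^sub>0)\<^sup>z\<close> with an integer exponent. Working with these ratios keeps every expression
  homogeneous of degree \<open>0\<close> in \<open>x\<^sub>0, \<dots>, x\<^sub>n\<close>.
\<close>

definition ypow :: "nat \<Rightarrow> int \<Rightarrow> laurent"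
  where "ypow l z = Poly_Mapping.single (Poly_Mapping.single l z - Poly_Mapping.single 0 z) 1"

lemma ypow_add: "ypow l (x + z) = ypow l x * ypow l z"
  by (simp add: ypow_def mult_single single_add algebra_simps)

lemma ypow_0 [simp]: "ypow l 0 = 1"
  by (simp add: ypow_def)

lemma var_ratio_eq_ypow: "var_ratio l m = ypow l 1 * ypow m (- 1)"
  by (simp add: ypow_def var_ratio_def mult_single single_uminus)

lemma ypow_base [simp]: "ypow 0 z = 1"
  by (simp add: ypow_def)

lemma swap_ypow:
  assumes "i \<noteq> 0" "j \<noteq> 0"
  shows "swap.subst i j (ypow l z) = ypow (Transposition.transpose i j l) z"
  using assms
  by (simp add: ypow_def swap.subst_term swap.map_diff swap_exponents_single transpose_apply_other)

lemma inversion_ypow: "inversion.subst (ypow l z) = ypow l (- z)"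
  by (simp add: ypow_def inversion.subst_term single_uminus)

lemma euler_ypow_same: "i \<noteq> 0 \<Longrightarrow> euler i (ypow i z) = of_int z * ypow i z"
  by (simp add: ypow_def euler_term lookup_minus lookup_single)

lemma euler_ypow_other: "i \<noteq> 0 \<Longrightarrow> i \<noteq> l \<Longrightarrow> euler i (ypow l z) = 0"
  by (simp add: ypow_def euler_term lookup_minus lookup_single)

section \<open>The weight of Morris' identity\<close>

definition end_factor :: "nat \<Rightarrow> nat \<Rightarrow> nat \<Rightarrow> laurent"
  where "end_factor a b l = (1 - var_ratio l 0) ^ a * (1 - var_ratio 0 l) ^ b"

definition pair_factor :: "nat \<Rightarrow> nat \<Rightarrow> laurent"
  where "pair_factor i j = (1 - var_ratio i j) * (1 - var_ratio j i)"

text \<open>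
  The variables are an arbitrary set \<open>S\<close> of indices, which is what inductions over the variables need.
\<close>

definition weight :: "nat \<Rightarrow> nat \<Rightarrow> nat \<Rightarrow> nat set \<Rightarrow> laurent"
  where "weight a b k S =
    (\<Prod>l\<in>S. end_factor a b l) * (\<Prod>(i, j)\<in>offdiag S. (1 - var_ratio i j) ^ k)"

text \<open>
  What remains of the weight after removing \<open>((1 - x\<^sub>i / x\<^sub>j) (1 - x\<^sub>j / x\<^sub>i))\<^sup>k\<close>, spelled out so that its
  symmetry under the exchange of \<open>x\<^sub>i\<close> and \<open>x\<^sub>j\<close> is evident.
\<close>

definition weight_off_pair :: "nat \<Rightarrow> nat \<Rightarrow> nat \<Rightarrow> nat set \<Rightarrow> nat \<Rightarrow> nat \<Rightarrow> laurent"
  where "weight_off_pair a b k S i j =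
    end_factor a b i * end_factor a b j
    * (\<Prod>l\<in>S - {i, j}. pair_factor i l ^ k * pair_factor j l ^ k) * weight a b k (S - {i, j})"

lemma prod_offdiag_insert:
  fixes f :: "nat \<Rightarrow> nat \<Rightarrow> 'a :: comm_monoid_mult"
  assumes "finite S" "i \<notin> S"
  shows "(\<Prod>(p, q)\<in>offdiag (insert i S). f p q)
    = (\<Prod>j\<in>S. f i j * f j i) * (\<Prod>(p, q)\<in>offdiag S. f p q)"
proof -
  have fin: "finite (offdiag S)"
    by (rule finite_subset[of _ "S \<times> S"]) (auto simp: offdiag_def assms)
  have split: "offdiag (insert i S) = Pair i ` S \<union> ((\<lambda>j. (j, i)) ` S \<union> offdiag S)"
    using assms by (auto simp: offdiag_def)
  have "(\<Prod>(p, q)\<in>offdiag (insert i S). f p q)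
    = (\<Prod>(p, q)\<in>Pair i ` S. f p q) * ((\<Prod>(p, q)\<in>(\<lambda>j. (j, i)) ` S. f p q) * (\<Prod>(p, q)\<in>offdiag S. f p q))"
    unfolding split using assms fin
    by (subst prod.union_disjoint; (subst prod.union_disjoint)?) (auto simp: offdiag_def)
  also have "(\<Prod>(p, q)\<in>Pair i ` S. f p q) = (\<Prod>j\<in>S. f i j)"
    by (subst prod.reindex) (auto simp: inj_on_def)
  also have "(\<Prod>(p, q)\<in>(\<lambda>j. (j, i)) ` S. f p q) = (\<Prod>j\<in>S. f j i)"
    by (subst prod.reindex) (auto simp: inj_on_def)
  finally show ?thesis
    by (simp add: prod.distrib mult.assoc)
qed

lemma weight_insert:
  assumes "finite S" "i \<notin> S"
  shows "weight a b k (insert i S)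
    = end_factor a b i * (\<Prod>j\<in>S. pair_factor i j ^ k) * weight a b k S"
  using assms
  by (simp add: weight_def prod_offdiag_insert pair_factor_def power_mult_distrib mult_ac)

lemma weight_pair:
  assumes "finite S" "i \<in> S" "j \<in> S" "i \<noteq> j"
  shows "weight a b k S = pair_factor i j ^ k * weight_off_pair a b k S i j"
proof -
  have S: "S = insert i (insert j (S - {i, j}))"
    using assms by auto
  show ?thesis
    by (subst S) (use assms in \<open>simp add: weight_insert weight_off_pair_def prod.distrib mult_ac\<close>)
qed

text \<open>
  The logarithmic derivative of the end factor has its only pole at \<open>y\<^sub>i = 1\<close>, and \<open>y\<^sub>i - 1\<close> cancels it.
\<close>

lemma euler_end_factor:
  assumes "i \<noteq> 0"
  shows "(ypow i 1 - 1) * euler i (end_factor a b i)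
    = (of_nat a * ypow i 1 + of_nat b) * end_factor a b i"
proof -
  have y: "ypow i (- 1) * ypow i 1 = 1"
    by (simp flip: ypow_add)
  have e: "end_factor a b i = (1 - ypow i 1) ^ a * (1 - ypow i (- 1)) ^ b"
    by (simp add: end_factor_def var_ratio_eq_ypow)
  have 1: "(ypow i 1 - 1) * euler i ((1 - ypow i 1) ^ a) = of_nat a * ypow i 1 * (1 - ypow i 1) ^ a"
  proof (cases a)
    case (Suc a')
    have "(ypow i 1 - 1) * euler i ((1 - ypow i 1) ^ a)
        = of_nat a * ypow i 1 * ((1 - ypow i 1) ^ a' * (1 - ypow i 1))"
      unfolding Suc using assms
      by (simp add: euler_power euler_diff euler_ypow_same algebra_simps del: power_Suc of_nat_Suc)
    then show ?thesis
      by (simp add: Suc mult_ac)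
  qed simp
  have 2: "(ypow i 1 - 1) * euler i ((1 - ypow i (- 1)) ^ b) = of_nat b * (1 - ypow i (- 1)) ^ b"
  proof (cases b)
    case (Suc b')
    have "(ypow i 1 - 1) * euler i ((1 - ypow i (- 1)) ^ b)
        = of_nat b * (1 - ypow i (- 1)) ^ b' * (ypow i (- 1) * ypow i 1 - ypow i (- 1))"
      unfolding Suc using assms
      by (simp add: euler_power euler_diff euler_ypow_same algebra_simps del: power_Suc of_nat_Suc)
    also have "ypow i (- 1) * ypow i 1 - ypow i (- 1) = 1 - ypow i (- 1)"
      by (simp only: y)
    finally show ?thesis
      by (simp only: Suc power_Suc2 mult.assoc)
  qed simp
  have "(ypow i 1 - 1) * euler i (end_factor a b i)
      = ((ypow i 1 - 1) * euler i ((1 - ypow i 1) ^ a)) * (1 - ypow i (- 1)) ^ b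
      + (1 - ypow i 1) ^ a * ((ypow i 1 - 1) * euler i ((1 - ypow i (- 1)) ^ b))"
    unfolding e euler_mult by (simp only: distrib_left mult_ac)
  also have "\<dots> = (of_nat a * ypow i 1 + of_nat b) * end_factor a b i"
    unfolding 1 2 e by (simp only: distrib_right distrib_left mult_ac)
  finally show ?thesis .
qed

lemma euler_weight_other:
  assumes "i \<notin> S" "i \<noteq> 0"
  shows "euler i (weight a b k S) = 0"
proof -
  have "euler i ((\<Prod>l\<in>S. end_factor a b l)) = 0"
    using assms
    by (intro euler_prod_eq_0)
       (auto simp: end_factor_def euler_mult euler_power euler_diff euler_var_ratio)
  moreover have "euler i (\<Prod>(p, q)\<in>offdiag S. (1 - var_ratio p q) ^ k) = 0"
    using assms
    by (intro euler_prod_eq_0)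
       (auto simp: offdiag_def euler_power euler_diff euler_var_ratio)
  ultimately show ?thesis
    by (simp add: weight_def euler_mult)
qed

text \<open>
  The product rule, with the factors that contain \<open>x\<^sub>i\<close> separated from the rest. The sum over \<open>j\<close>
  is kept with the exponent \<open>k - 1\<close> of the pair factor, because dividing by it is not possible
  in the ring of Laurent polynomials; for \<open>k = 0\<close> the coefficient \<open>of_nat k\<close> makes the truncated exponent
  harmless.
\<close>

lemma euler_weight:
  assumes "finite S" "i \<in> S" "i \<noteq> 0"
  shows "(ypow i 1 - 1) * euler i (weight a b k S)
    = (of_nat a * ypow i 1 + of_nat b) * weight a b k S
      + (\<Sum>j\<in>S - {i}. of_nat k * ((ypow i 1 - 1) * euler i (pair_factor i j)
           * pair_factor i j ^ (k - 1) * weight_off_pair a b k S i j))"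
proof -
  define T where "T = S - {i}"
  have T: "finite T" "i \<notin> T" "S = insert i T"
    using assms by (auto simp: T_def)
  have summand: "end_factor a b i * (euler i (pair_factor i j ^ k)
        * (\<Prod>l\<in>T - {j}. pair_factor i l ^ k)) * weight a b k T
      = of_nat k * (euler i (pair_factor i j)
           * pair_factor i j ^ (k - 1) * weight_off_pair a b k S i j)" if "j \<in> T" for j
  proof -
    have *: "S - {i, j} = T - {j}"
      using T by auto
    have "weight a b k (insert j (T - {j}))
        = end_factor a b j * (\<Prod>l\<in>T - {j}. pair_factor j l ^ k) * weight a b k (T - {j})"
      using T by (subst weight_insert) auto
    then show ?thesis
      using that by (simp add: insert_absorb * weight_off_pair_def euler_power prod.distrib mult_ac)
  qed
  have "euler i (weight a b k S)
      = euler i (end_factor a b i) * (\<Prod>j\<in>T. pair_factor i j ^ k) * weight a b k T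
      + end_factor a b i * (\<Sum>j\<in>T. euler i (pair_factor i j ^ k)
           * (\<Prod>l\<in>T - {j}. pair_factor i l ^ k)) * weight a b k T"
    using T assms
    by (simp add: weight_insert euler_mult euler_weight_other euler_prod[of T] algebra_simps)
  also have "end_factor a b i * (\<Sum>j\<in>T. euler i (pair_factor i j ^ k)
           * (\<Prod>l\<in>T - {j}. pair_factor i l ^ k)) * weight a b k T
     = (\<Sum>j\<in>T. of_nat k * (euler i (pair_factor i j)
           * pair_factor i j ^ (k - 1) * weight_off_pair a b k S i j))"
    unfolding sum_distrib_left sum_distrib_right by (intro sum.cong refl summand)
  finally have "(ypow i 1 - 1) * euler i (weight a b k S)
      = ((ypow i 1 - 1) * euler i (end_factor a b i)) * (\<Prod>j\<in>T. pair_factor i j ^ k) * weight a b k T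
      + (ypow i 1 - 1) * (\<Sum>j\<in>T. of_nat k * (euler i (pair_factor i j)
           * pair_factor i j ^ (k - 1) * weight_off_pair a b k S i j))"
    by (simp only: distrib_left mult.assoc)
  moreover have "((ypow i 1 - 1) * euler i (end_factor a b i)) * (\<Prod>j\<in>T. pair_factor i j ^ k) * weight a b k T
      = (of_nat a * ypow i 1 + of_nat b) * weight a b k S"
    unfolding euler_end_factor[OF \<open>i \<noteq> 0\<close>] using T by (simp add: weight_insert mult.assoc)
  ultimately show ?thesis
    by (simp add: sum_distrib_left mult_ac flip: T_def)
qed

lemma swap_end_factor:
  assumes "i \<noteq> 0" "j \<noteq> 0"
  shows "swap.subst i j (end_factor a b l) = end_factor a b (Transposition.transpose i j l)"
  using assms
  by (simp add: end_factor_def swap.subst_mult swap.subst_power swap.subst_diff swap_var_ratio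
      transpose_apply_other)

lemma swap_pair_factor:
  "swap.subst i j (pair_factor l m)
     = pair_factor (Transposition.transpose i j l) (Transposition.transpose i j m)"
  by (simp add: pair_factor_def swap.subst_mult swap.subst_diff swap_var_ratio)

lemma pair_factor_sym: "pair_factor i j = pair_factor j i"
  by (simp add: pair_factor_def mult.commute)

lemma swap_weight_other:
  assumes "i \<notin> S" "j \<notin> S" "0 \<notin> S" "i \<noteq> 0 \<and> j \<noteq> 0 \<or> a = 0 \<and> b = 0"
  shows "swap.subst i j (weight a b k S) = weight a b k S"
proof -
  have tr: "Transposition.transpose i j l = l" if "l \<in> S" for l
    using that assms by (metis transpose_apply_other)
  have "(\<Prod>l\<in>S. swap.subst i j (end_factor a b l)) = (\<Prod>l\<in>S. end_factor a b l)"
    using assms(4) by (intro prod.cong refl) (auto simp: swap_end_factor tr, simp add: end_factor_def)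
  moreover have "(\<Prod>x\<in>offdiag S. swap.subst i j (case x of (p, q) \<Rightarrow> (1 - var_ratio p q) ^ k))
      = (\<Prod>(p, q)\<in>offdiag S. (1 - var_ratio p q) ^ k)"
    by (intro prod.cong refl)
       (auto simp: offdiag_def swap.subst_power swap.subst_diff swap_var_ratio tr)
  ultimately show ?thesis
    by (simp add: weight_def swap.subst_mult swap.subst_prod)
qed

lemma swap_weight_off_pair:
  assumes "i \<noteq> 0" "j \<noteq> 0" "0 \<notin> S"
  shows "swap.subst i j (weight_off_pair a b k S i j) = weight_off_pair a b k S i j"
proof -
  have "(\<Prod>l\<in>S - {i, j}. swap.subst i j (pair_factor i l ^ k * pair_factor j l ^ k))
      = (\<Prod>l\<in>S - {i, j}. pair_factor i l ^ k * pair_factor j l ^ k)"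
    by (intro prod.cong refl)
       (auto simp: swap.subst_mult swap.subst_power swap_pair_factor transpose_apply_other mult.commute)
  then show ?thesis
    using assms
    by (simp add: weight_off_pair_def swap.subst_mult swap.subst_prod swap_end_factor
        swap_weight_other mult_ac)
qed

lemma swap_weight:
  assumes "finite S" "0 \<notin> S" "i \<in> S" "j \<in> S"
  shows "swap.subst i j (weight a b k S) = weight a b k S"
proof (cases "i = j")
  case True
  have "swap_exponents j j e = e" for e
    by (rule poly_mapping_eqI) (simp add: lookup_swap_exponents)
  then have "swap.subst j j p = p" for p
    by (intro poly_mapping_eqI) (simp add: swap.lookup_subst)
  then show ?thesis using True by simp
next
  case False
  moreover have "i \<noteq> 0" "j \<noteq> 0" using assms by metis+
  ultimately show ?thesis
    using assms
    by (simp add: weight_pair swap.subst_mult swap.subst_power swap_pair_factor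
        swap_weight_off_pair pair_factor_sym[of j i])
qed

lemma inversion_weight: "inversion.subst (weight a b k S) = weight b a k S"
proof -
  have "inversion.subst (end_factor a b l) = end_factor b a l" for l
    by (simp add: end_factor_def inversion.subst_mult inversion.subst_power
        inversion.subst_diff inversion_var_ratio mult.commute)
  moreover have "(\<Prod>x\<in>offdiag S. inversion.subst (case x of (p, q) \<Rightarrow> (1 - var_ratio p q) ^ k))
      = (\<Prod>(p, q)\<in>offdiag S. (1 - var_ratio p q) ^ k)"
    by (rule prod.reindex_bij_witness[of _ prod.swap prod.swap])
       (auto simp: offdiag_def inversion.subst_power inversion.subst_diff inversion_var_ratio)
  ultimately show ?thesis
    by (simp add: weight_def inversion.subst_mult inversion.subst_prod)
qed

section \<open>Moments and integration by parts\<close>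

definition moment :: "nat \<Rightarrow> nat \<Rightarrow> nat \<Rightarrow> nat set \<Rightarrow> laurent \<Rightarrow> rat"
  where "moment a b k S f = CT (f * weight a b k S)"

lemma moment_add: "moment a b k S (f + g) = moment a b k S f + moment a b k S g"
  and moment_diff: "moment a b k S (f - g) = moment a b k S f - moment a b k S g"
  and moment_of_nat: "moment a b k S (of_nat m * f) = of_nat m * moment a b k S f"
  and moment_numeral: "moment a b k S (numeral w * f) = numeral w * moment a b k S f"
  and moment_sum: "moment a b k S (sum h A) = (\<Sum>x\<in>A. moment a b k S (h x))"
  by (simp_all add: moment_def distrib_right left_diff_distrib mult.assoc CT_add CT_diff
      CT_of_nat_mult CT_numeral_mult sum_distrib_right CT_sum)

lemma moment_swap:
  assumes "finite S" "0 \<notin> S" "i \<in> S" "j \<in> S"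
  shows "moment a b k S (swap.subst i j f) = moment a b k S f"
  using swap.CT_subst[of i j "f * weight a b k S"] swap_weight[OF assms]
  by (simp add: moment_def swap.subst_mult)

lemma moment_inversion: "moment a b k S (inversion.subst f) = moment b a k S f"
  using inversion.CT_subst[of "f * weight b a k S"]
  by (simp add: moment_def inversion.subst_mult inversion_weight)

text \<open>
  The contribution of the pair \<open>i, j\<close> to integration by parts against \<open>h\<close>. Formally it is the moment of
  \<open>k h (y\<^sub>i + y\<^sub>j) / (y\<^sub>i - y\<^sub>j)\<close>, written without the division.
\<close>

definition pair_moment :: "nat \<Rightarrow> nat \<Rightarrow> nat \<Rightarrow> nat set \<Rightarrow> nat \<Rightarrow> nat \<Rightarrow> laurent \<Rightarrow> rat"
  where "pair_moment a b k S i j h = of_nat k * CT (h * (euler i (pair_factor i j)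
           * pair_factor i j ^ (k - 1) * weight_off_pair a b k S i j))"

lemma pair_moment_diff:
  "pair_moment a b k S i j (f - g) = pair_moment a b k S i j f - pair_moment a b k S i j g"
  by (simp add: pair_moment_def left_diff_distrib CT_diff algebra_simps)

text \<open>
  The constant term of the Euler derivative of \<open>(y\<^sub>i - 1) g\<close> times the weight vanishes; the three summands
  come from differentiating \<open>(y\<^sub>i - 1) g\<close>, the end factor and the pair factors.
\<close>

proposition integration_by_parts:
  assumes "finite S" "0 \<notin> S" "i \<in> S"
  shows "moment a b k S (euler i ((ypow i 1 - 1) * g))
      + moment a b k S ((of_nat a * ypow i 1 + of_nat b) * g)
      + (\<Sum>j\<in>S - {i}. pair_moment a b k S i j ((ypow i 1 - 1) * g)) = 0"
proof -
  have "i \<noteq> 0" using assms by metis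
  have "0 = CT (euler i ((ypow i 1 - 1) * g * weight a b k S))"
    by simp
  also have "\<dots> = CT (euler i ((ypow i 1 - 1) * g) * weight a b k S
      + g * ((ypow i 1 - 1) * euler i (weight a b k S)))"
    unfolding euler_mult[of i "(ypow i 1 - 1) * g" "weight a b k S"]
    by (simp only: mult_ac)
  also have "\<dots> = moment a b k S (euler i ((ypow i 1 - 1) * g))
      + moment a b k S ((of_nat a * ypow i 1 + of_nat b) * g)
      + (\<Sum>j\<in>S - {i}. pair_moment a b k S i j ((ypow i 1 - 1) * g))"
    unfolding euler_weight[OF assms(1,3) \<open>i \<noteq> 0\<close>]
    unfolding distrib_left[of g] sum_distrib_left mult.left_commute[of g "of_nat k"]
      CT_add CT_sum CT_of_nat_mult moment_def pair_moment_def
    by (simp only: mult_ac add.assoc)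
  finally show ?thesis by simp
qed

text \<open>
  The second equation says that the logarithmic derivative of the pair factor is
  \<open>(y\<^sub>i + y\<^sub>j) / (y\<^sub>i - y\<^sub>j)\<close>. Its antisymmetry makes pair moments antisymmetric.
\<close>

lemma euler_pair_factor:
  assumes "i \<noteq> 0" "j \<noteq> 0" "i \<noteq> j"
  shows "euler i (pair_factor i j) = var_ratio j i - var_ratio i j"
    and "(ypow i 1 - ypow j 1) * euler i (pair_factor i j)
      = (ypow i 1 + ypow j 1) * pair_factor i j"
    and "swap.subst i j (euler i (pair_factor i j)) = - euler i (pair_factor i j)"
proof -
  have *: "var_ratio i j * var_ratio j i = 1"
    by (simp add: var_ratio_def mult_single)
  have D: "pair_factor i j = 2 - var_ratio i j - var_ratio j i"
    using * by (simp add: pair_factor_def algebra_simps)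
  show 1: "euler i (pair_factor i j) = var_ratio j i - var_ratio i j"
  proof -
    have "euler i (pair_factor i j) = 0 - euler i (var_ratio i j) - euler i (var_ratio j i)"
      by (simp only: D euler_diff euler_numeral)
    then show ?thesis
      using assms by (simp only: euler_var_ratio) simp
  qed
  have yy: "ypow j 1 * var_ratio i j = ypow i 1" "ypow i 1 * var_ratio j i = ypow j 1"
    using ypow_add[of j 1 "-1"] ypow_add[of i 1 "-1"]
    by (simp_all add: var_ratio_eq_ypow mult.left_commute[of "ypow j 1" "ypow i 1"]
        mult.left_commute[of "ypow i 1" "ypow j 1"])
  show "(ypow i 1 - ypow j 1) * euler i (pair_factor i j)
      = (ypow i 1 + ypow j 1) * pair_factor i j"
    unfolding 1 unfolding D
    by (simp add: algebra_simps yy yy[unfolded mult.commute[of "ypow _ 1"]])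
  show "swap.subst i j (euler i (pair_factor i j)) = - euler i (pair_factor i j)"
    unfolding 1 by (simp add: swap.subst_diff swap_var_ratio)
qed

lemma pair_moment_swap:
  assumes "0 \<notin> S" "i \<in> S" "j \<in> S" "i \<noteq> j"
  shows "pair_moment a b k S i j (swap.subst i j h) = - pair_moment a b k S i j h"
proof -
  have ij: "i \<noteq> 0" "j \<noteq> 0" using assms by metis+
  have "CT (h * (euler i (pair_factor i j) * pair_factor i j ^ (k - 1) * weight_off_pair a b k S i j))
      = CT (swap.subst i j (h * (euler i (pair_factor i j) * pair_factor i j ^ (k - 1)
          * weight_off_pair a b k S i j)))"
    by simp
  also have "\<dots> = CT (- (swap.subst i j h * (euler i (pair_factor i j) * pair_factor i j ^ (k - 1)
          * weight_off_pair a b k S i j)))"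
    using assms ij
    by (simp add: swap.subst_mult swap.subst_power swap_pair_factor pair_factor_sym[of j i]
        swap_weight_off_pair euler_pair_factor(3) del: swap.CT_subst)
  finally show ?thesis
    by (simp add: pair_moment_def CT_uminus)
qed

text \<open>
  Since the pair moment is antisymmetric, only the antisymmetric part of \<open>h\<close> counts, and that part is
  divisible by \<open>y\<^sub>i - y\<^sub>j\<close>. The quotient cancels the denominator, which turns the pair moment into an
  ordinary moment.
\<close>

lemma pair_moment_divided_difference:
  assumes "finite S" "0 \<notin> S" "i \<in> S" "j \<in> S" "i \<noteq> j"
    and "h - swap.subst i j h = (ypow i 1 - ypow j 1) * q"
  shows "2 * pair_moment a b k S i j h = of_nat k * moment a b k S ((ypow i 1 + ypow j 1) * q)"
proof (cases "k = 0")
  case False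
  have ij: "i \<noteq> 0" "j \<noteq> 0" using assms by metis+
  have "2 * pair_moment a b k S i j h = pair_moment a b k S i j (h - swap.subst i j h)"
    using pair_moment_swap[OF assms(2-5), of a b k h] by (simp add: pair_moment_diff)
  also have "\<dots> = of_nat k * CT (q * ((ypow i 1 - ypow j 1) * euler i (pair_factor i j)
           * pair_factor i j ^ (k - 1) * weight_off_pair a b k S i j))"
    by (simp add: assms(6) pair_moment_def mult_ac)
  also have "\<dots> = of_nat k * CT (q * ((ypow i 1 + ypow j 1) * 
      (pair_factor i j ^ k * weight_off_pair a b k S i j)))"
    unfolding euler_pair_factor(2)[OF ij \<open>i \<noteq> j\<close>]
    using False by (simp add: mult_ac power_eq_if[of _ k])
  also have "\<dots> = of_nat k * moment a b k S ((ypow i 1 + ypow j 1) * q)"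
    by (simp add: moment_def weight_pair[OF assms(1,3,4,5)] mult_ac)
  finally show ?thesis .
qed (simp add: pair_moment_def)

section \<open>Morris' constant term identity\<close>

definition yprod :: "nat set \<Rightarrow> laurent"
  where "yprod T = (\<Prod>l\<in>T. ypow l 1)"

lemma yprod_insert: "finite T \<Longrightarrow> l \<notin> T \<Longrightarrow> yprod (insert l T) = ypow l 1 * yprod T"
  by (simp add: yprod_def)

lemma swap_yprod:
  assumes "i \<noteq> 0" "j \<noteq> 0" "i \<notin> T" "j \<notin> T"
  shows "swap.subst i j (yprod T) = yprod T"
proof -
  have "(\<Prod>l\<in>T. swap.subst i j (ypow l 1)) = (\<Prod>l\<in>T. ypow l 1)"
    by (intro prod.cong refl) (metis assms swap_ypow transpose_apply_other)
  then show ?thesis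
    by (simp add: yprod_def swap.subst_prod)
qed

text \<open>
  Integration by parts with \<open>g = \<Prod>\<^bsub>l \<in> T\<^esub> y\<^sub>l\<close>. The divided difference for \<open>j \<in> T\<close> gives back the product
  over \<open>T\<close>, since the parts with \<open>y\<^sub>i y\<^sub>j\<close> cancel; for \<open>j \<notin> T\<close> it gives the product over
  \<open>insert i T\<close>. So just two moments occur.
\<close>

lemma aomoto_recursion:
  assumes S: "finite S" "0 \<notin> S" "i \<in> S" and T: "T \<subseteq> S" "i \<notin> T"
  shows "(of_nat a + 1 + of_nat k * (of_nat (card S) - of_nat (card T) - 1))
            * moment a b k S (yprod (insert i T))
       + (of_nat b + of_nat k * of_nat (card T)) * moment a b k S (yprod T) = 0"
proof -
  have i: "i \<noteq> 0" using S by metis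
  have fin: "finite T" using S T finite_subset by auto
  have ins: "yprod (insert i T) = ypow i 1 * yprod T"
    using fin T by (simp add: yprod_insert)
  have in_T: "pair_moment a b k S i j ((ypow i 1 - 1) * yprod T) = of_nat k * moment a b k S (yprod T)"
    if j: "j \<in> T" for j
  proof -
    have ij: "i \<noteq> j" "j \<in> S" using j S T by auto
    then have "j \<noteq> 0" using S by metis
    note ij = ij this
    define R where "R = yprod (T - {j})"
    have T_eq: "yprod T = ypow j 1 * R"
      using yprod_insert[of "T - {j}" j] fin j by (simp add: R_def insert_absorb)
    have R: "swap.subst i j R = R"
      unfolding R_def using i ij T by (intro swap_yprod) auto
    have "moment a b k S (ypow i 1 * R) = moment a b k S (swap.subst i j (ypow i 1 * R))"
      using S ij by (simp add: moment_swap)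
    also have "swap.subst i j (ypow i 1 * R) = yprod T"
      using i ij by (simp add: swap.subst_mult swap_ypow R T_eq)
    finally have *: "moment a b k S (ypow i 1 * R) = moment a b k S (yprod T)" .
    have "2 * pair_moment a b k S i j ((ypow i 1 - 1) * yprod T)
        = of_nat k * moment a b k S ((ypow i 1 + ypow j 1) * R)"
      using S ij i
      by (intro pair_moment_divided_difference)
         (simp_all add: T_eq swap.subst_mult swap.subst_diff swap_ypow R algebra_simps)
    also have "\<dots> = 2 * (of_nat k * moment a b k S (yprod T))"
      using * by (simp add: distrib_right moment_add T_eq)
    finally show ?thesis by simp
  qed
  have not_in_T: "pair_moment a b k S i j ((ypow i 1 - 1) * yprod T)
      = of_nat k * moment a b k S (yprod (insert i T))" if j: "j \<in> S - {i} - T" for j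
  proof -
    have ij: "i \<noteq> j" "j \<in> S" using j S T by auto
    then have "j \<noteq> 0" using S by metis
    note ij = ij this
    have R: "swap.subst i j (yprod T) = yprod T"
      using i ij T j by (intro swap_yprod) auto
    have "moment a b k S (ypow j 1 * yprod T) = moment a b k S (swap.subst i j (ypow j 1 * yprod T))"
      using S ij by (simp add: moment_swap)
    also have "swap.subst i j (ypow j 1 * yprod T) = yprod (insert i T)"
      using i ij by (simp add: swap.subst_mult swap_ypow R ins)
    finally have *: "moment a b k S (ypow j 1 * yprod T) = moment a b k S (yprod (insert i T))" .
    have "2 * pair_moment a b k S i j ((ypow i 1 - 1) * yprod T)
        = of_nat k * moment a b k S ((ypow i 1 + ypow j 1) * yprod T)"
      using S ij i
      by (intro pair_moment_divided_difference)
         (simp_all add: swap.subst_mult swap.subst_diff swap_ypow R algebra_simps)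
    also have "\<dots> = 2 * (of_nat k * moment a b k S (yprod (insert i T)))"
      using * by (simp add: distrib_right moment_add ins)
    finally show ?thesis by simp
  qed
  have "card T \<le> card (S - {i})"
    using S T by (intro card_mono) auto
  moreover have "card (S - {i} - T) = card (S - {i}) - card T"
    using T fin by (intro card_Diff_subset) auto
  moreover have "card S = Suc (card (S - {i}))"
    using S card.remove by metis
  ultimately have "card S = card T + card (S - {i} - T) + 1"
    by simp
  then have card: "of_nat (card (S - {i} - T)) = (of_nat (card S) - of_nat (card T) - 1 :: rat)"
    by simp
  have "(\<Sum>j\<in>S - {i}. pair_moment a b k S i j ((ypow i 1 - 1) * yprod T))
      = (\<Sum>j\<in>S - {i} - T. pair_moment a b k S i j ((ypow i 1 - 1) * yprod T))
      + (\<Sum>j\<in>T. pair_moment a b k S i j ((ypow i 1 - 1) * yprod T))"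
    using S T by (intro sum.subset_diff) auto
  also have "\<dots> = (of_nat (card S) - of_nat (card T) - 1)
        * (of_nat k * moment a b k S (yprod (insert i T)))
      + of_nat (card T) * (of_nat k * moment a b k S (yprod T))"
    by (simp only: in_T not_in_T sum_constant card cong: sum.cong)
  finally have "(\<Sum>j\<in>S - {i}. pair_moment a b k S i j ((ypow i 1 - 1) * yprod T))
      = (of_nat (card S) - of_nat (card T) - 1)
        * (of_nat k * moment a b k S (yprod (insert i T)))
      + of_nat (card T) * (of_nat k * moment a b k S (yprod T))" .
  moreover have "euler i ((ypow i 1 - 1) * yprod T) = yprod (insert i T)"
  proof -
    have "euler i (yprod T) = 0"
      unfolding yprod_def using T i by (intro euler_prod_eq_0 euler_ypow_other) auto
    then show ?thesis
      using i by (simp add: euler_mult euler_diff euler_ypow_same ins)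
  qed
  moreover have "moment a b k S ((of_nat a * ypow i 1 + of_nat b) * yprod T)
      = of_nat a * moment a b k S (yprod (insert i T)) + of_nat b * moment a b k S (yprod T)"
    by (simp add: distrib_right mult.assoc moment_add moment_of_nat ins)
  ultimately show ?thesis
    using integration_by_parts[OF S, of a b k "yprod T"]
    by (simp add: algebra_simps)
qed

lemma moment_yprod:
  assumes S: "finite S" "0 \<notin> S" and "T \<subseteq> S"
  shows "moment a b k S (yprod T)
      * (\<Prod>l<card T. of_nat a + 1 + of_nat k * (of_nat (card S) - of_nat l - 1))
    = (- 1) ^ card T * (\<Prod>l<card T. of_nat b + of_nat k * of_nat l) * moment a b k S 1"
proof -
  have "finite T" using assms finite_subset by auto
  then show ?thesis using \<open>T \<subseteq> S\<close>
  proof (induction T)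
    case (insert i T)
    define P where "P = (\<Prod>l<card T. of_nat a + 1 + of_nat k * (of_nat (card S) - of_nat l - 1) :: rat)"
    have card: "card (insert i T) = Suc (card T)"
      using insert by simp
    have step: "(of_nat a + 1 + of_nat k * (of_nat (card S) - of_nat (card T) - 1))
            * moment a b k S (yprod (insert i T))
       = - 1 * (of_nat b + of_nat k * of_nat (card T)) * moment a b k S (yprod T)"
      using aomoto_recursion[OF S, of i T a k b] insert
      by (simp add: add_eq_0_iff algebra_simps)
    have "moment a b k S (yprod (insert i T))
          * (P * (of_nat a + 1 + of_nat k * (of_nat (card S) - of_nat (card T) - 1)))
        = ((of_nat a + 1 + of_nat k * (of_nat (card S) - of_nat (card T) - 1))
            * moment a b k S (yprod (insert i T))) * P"
      by (simp only: mult_ac)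
    also have "\<dots> = - 1 * (of_nat b + of_nat k * of_nat (card T)) * (moment a b k S (yprod T) * P)"
      unfolding step by (simp only: mult_ac)
    also have "moment a b k S (yprod T) * P
        = (- 1) ^ card T * (\<Prod>l<card T. of_nat b + of_nat k * of_nat l) * moment a b k S 1"
      using insert by (simp only: P_def insert_subset)
    finally show ?case
      by (simp only: P_def card prod.lessThan_Suc power_Suc mult_ac)
  qed (simp add: yprod_def)
qed

lemma end_factor_shift: "ypow l 1 * end_factor a (Suc b) l = - end_factor (Suc a) b l"
proof -
  have "ypow l 1 * (1 - ypow l (- 1)) = - (1 - ypow l 1)"
    by (simp add: algebra_simps flip: ypow_add)
  then have "(ypow l 1 * (1 - ypow l (- 1))) * ((1 - ypow l 1) ^ a * (1 - ypow l (- 1)) ^ b)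
      = - ((1 - ypow l 1) * ((1 - ypow l 1) ^ a * (1 - ypow l (- 1)) ^ b))"
    by (simp only: mult_minus_left)
  then show ?thesis
    by (simp only: end_factor_def var_ratio_eq_ypow ypow_base mult_1_left mult_1_right power_Suc mult_ac)
qed

text \<open>
  Because \<open>y (1 - 1 / y) = - (1 - y)\<close>, multiplying by all \<open>y\<^sub>l\<close> moves one unit from \<open>b\<close> to \<open>a\<close>.
\<close>

lemma weight_shift:
  "yprod S * weight a (Suc b) k S = (- 1) ^ card S * weight (Suc a) b k S"
proof -
  have "(\<Prod>l\<in>S. ypow l 1 * end_factor a (Suc b) l) = (- 1) ^ card S * (\<Prod>l\<in>S. end_factor (Suc a) b l)"
    by (simp add: end_factor_shift prod_uminus)
  then show ?thesis
    by (simp add: yprod_def weight_def prod.distrib flip: mult.assoc)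
qed

lemma prod_nat_pos_rat: "(\<Prod>l<m. of_nat c + 1 + of_nat k * of_nat l) > (0 :: rat)"
proof (intro prod_pos ballI)
  fix l
  have "of_nat c + 1 + of_nat k * of_nat l = (of_nat (c + 1 + k * l) :: rat)" by simp
  then show "of_nat c + 1 + of_nat k * of_nat l > (0 :: rat)"
    by (simp only: of_nat_0_less_iff)
qed

lemma CT_weight_shift:
  assumes S: "finite S" "0 \<notin> S"
  shows "CT (weight (Suc a) b k S) * (\<Prod>l<card S. of_nat a + 1 + of_nat k * of_nat l)
       = CT (weight a (Suc b) k S) * (\<Prod>l<card S. of_nat b + 1 + of_nat k * of_nat l)"
proof -
  have "(\<Prod>l<card S. of_nat a + 1 + of_nat k * (of_nat (card S) - of_nat l - 1))
      = (\<Prod>l<card S. of_nat a + 1 + of_nat k * of_nat l :: rat)"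
    by (rule prod.reindex_bij_witness[of _ "\<lambda>l. card S - Suc l" "\<lambda>l. card S - Suc l"])
       (auto simp: of_nat_diff)
  moreover have "moment a (Suc b) k S (yprod S) = (- 1) ^ card S * CT (weight (Suc a) b k S)"
    using CT_of_int_mult[of "(- 1) ^ card S"] by (simp add: moment_def weight_shift)
  moreover have "moment a (Suc b) k S (yprod S)
      * (\<Prod>l<card S. of_nat a + 1 + of_nat k * (of_nat (card S) - of_nat l - 1))
    = (- 1) ^ card S * (\<Prod>l<card S. of_nat b + 1 + of_nat k * of_nat l) * CT (weight a (Suc b) k S)"
    using moment_yprod[OF S order_refl, of a "Suc b" k]
    by (simp only: moment_def mult_1_left of_nat_Suc add.commute[of 1])
  ultimately have "(- 1) ^ card S * (CT (weight (Suc a) b k S)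
        * (\<Prod>l<card S. of_nat a + 1 + of_nat k * of_nat l))
      = (- 1) ^ card S * (CT (weight a (Suc b) k S)
        * (\<Prod>l<card S. of_nat b + 1 + of_nat k * of_nat l))"
    by (simp only: mult_ac)
  then show ?thesis
    by (simp only: mult_cancel_left power_eq_0_iff neg_equal_0_iff_equal one_neq_zero simp_thms)
qed

text \<open>
  For \<open>b = 0\<close> the recursion starts with the factor \<open>0\<close>, so the moments of all nonempty products
  \<open>\<Prod> y\<^sub>l\<close> vanish, and only the term \<open>1\<close> of the expanded product survives.
\<close>

lemma moment_prod_one_minus:
  assumes S: "finite S" "0 \<notin> S" and "T \<subseteq> S"
  shows "moment a 0 k S (\<Prod>l\<in>T. 1 - ypow l 1) = moment a 0 k S 1"
proof -
  have zero: "moment a 0 k S (yprod U) = 0" if "U \<subseteq> S" "U \<noteq> {}" for U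
  proof -
    have fin: "finite U" using that S finite_subset by auto
    then have "card U > 0" using that by (simp add: card_gt_0_iff)
    then have zero: "(\<Prod>l<card U. of_nat 0 + of_nat k * of_nat l :: rat) = 0"
      by (intro prod_zero) auto
    have pos: "(\<Prod>l<card U. of_nat a + 1 + of_nat k * (of_nat (card S) - of_nat l - 1)) > (0 :: rat)"
    proof (intro prod_pos ballI)
      fix l assume "l \<in> {..<card U}"
      then have "l < card S" using card_mono[OF S(1) that(1)] by auto
      then have "of_nat l + 1 \<le> (of_nat (card S) :: rat)"
        by (metis Suc_leI of_nat_Suc of_nat_le_iff add.commute)
      then show "of_nat a + 1 + of_nat k * (of_nat (card S) - of_nat l - 1) > (0 :: rat)"
        by (intro add_pos_nonneg add_nonneg_pos mult_nonneg_nonneg) auto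
    qed
    have "moment a 0 k S (yprod U)
      * (\<Prod>l<card U. of_nat a + 1 + of_nat k * (of_nat (card S) - of_nat l - 1)) = 0"
      unfolding moment_yprod[OF S that(1)] zero by (simp only: mult_zero_left mult_zero_right)
    then show ?thesis
      unfolding mult_eq_0_iff using pos by (metis less_irrefl)
  qed
  have fin: "finite T" using assms finite_subset by auto
  \<comment> \<open>Stated for a further factor \<open>yprod U\<close> so that the induction over \<open>T\<close> goes through.\<close>
  have vanish: "moment a 0 k S ((\<Prod>l\<in>T. 1 - ypow l 1) * yprod U) = 0"
    if "T \<subseteq> S" "U \<subseteq> S" "U \<noteq> {}" "T \<inter> U = {}" "finite T" for T U
    using that(5,1-4)
  proof (induction T arbitrary: U)
    case empty
    then show ?case by (simp add: zero)
  next
    case (insert i T)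
    have "finite U" using insert S finite_subset by auto
    then have "(\<Prod>l\<in>insert i T. 1 - ypow l 1) * yprod U
      = (\<Prod>l\<in>T. 1 - ypow l 1) * yprod U - (\<Prod>l\<in>T. 1 - ypow l 1) * yprod (insert i U)"
      using insert by (simp add: yprod_insert algebra_simps)
    then show ?case
      using insert.IH[of U] insert.IH[of "insert i U"] insert by (simp add: moment_diff)
  qed
  show ?thesis using fin \<open>T \<subseteq> S\<close>
  proof (induction T)
    case (insert i T)
    have "(\<Prod>l\<in>insert i T. 1 - ypow l 1)
      = (\<Prod>l\<in>T. 1 - ypow l 1) - (\<Prod>l\<in>T. 1 - ypow l 1) * yprod {i}"
      using insert by (simp add: yprod_def algebra_simps)
    then show ?case
      using insert vanish[of T "{i}"] by (simp add: moment_diff)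
  qed simp
qed

lemma CT_weight_b_0:
  assumes S: "finite S" "0 \<notin> S"
  shows "CT (weight a 0 k S) = CT (weight 0 0 k S)"
proof (induction a)
  case (Suc a)
  have "weight (Suc a) 0 k S = (\<Prod>l\<in>S. 1 - ypow l 1) * weight a 0 k S"
    by (simp add: weight_def end_factor_def prod.distrib var_ratio_eq_ypow mult.assoc)
  then have "CT (weight (Suc a) 0 k S) = moment a 0 k S (\<Prod>l\<in>S. 1 - ypow l 1)"
    by (simp add: moment_def)
  also have "\<dots> = CT (weight a 0 k S)"
    using moment_prod_one_minus[OF S order_refl] by (simp add: moment_def)
  finally show ?case using Suc by simp
qed simp

text \<open>
  For \<open>a = b = 0\<close> the variable \<open>x\<^sub>0\<close> is absent. Exchanging it with \<open>x\<^sub>m\<close> turns the pair factors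
  that involve \<open>x\<^sub>m\<close> into end factors with exponents \<open>k\<close>.
\<close>

lemma CT_weight_insert:
  assumes S: "finite S" "0 \<notin> S" and m: "m \<notin> S" "m \<noteq> 0"
  shows "CT (weight 0 0 k (insert m S)) = CT (weight k k k S)"
proof -
  have "CT (weight 0 0 k (insert m S)) = CT (swap.subst 0 m (weight 0 0 k (insert m S)))"
    by simp
  also have "swap.subst 0 m (weight 0 0 k (insert m S))
      = (\<Prod>j\<in>S. pair_factor 0 j ^ k) * weight 0 0 k S"
  proof -
    have "(\<Prod>j\<in>S. swap.subst 0 m (pair_factor m j ^ k)) = (\<Prod>j\<in>S. pair_factor 0 j ^ k)"
      by (intro prod.cong refl)
         (metis assms(2,3) swap.subst_power swap_pair_factor transpose_apply_other transpose_apply_second)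
    moreover have "swap.subst 0 m (weight 0 0 k S) = weight 0 0 k S"
      using assms by (intro swap_weight_other) auto
    ultimately show ?thesis
      using assms by (simp add: weight_insert end_factor_def swap.subst_mult swap.subst_prod)
  qed
  also have "\<dots> = weight k k k S"
    by (simp add: weight_def end_factor_def pair_factor_def power_mult_distrib prod.distrib mult_ac)
  finally show ?thesis .
qed

lemma M_shift:
  "M n (Suc a) b k * (\<Prod>l<n. of_nat a + 1 + of_nat k * of_nat l)
    = M n a (Suc b) k * (\<Prod>l<n. of_nat b + 1 + of_nat k * of_nat l)"
  unfolding M_def prod.distrib[symmetric]
proof (intro prod.cong refl)
  fix l
  have "of_nat c + 1 + of_nat k * of_nat l = (of_nat (Suc (c + k * l)) :: rat)" for c by simp
  moreover have "fact (Suc c + k * l) = of_nat (Suc (c + k * l)) * (fact (c + k * l) :: rat)" for c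
    by simp
  moreover have "fact (Suc a + b + k * l) = (fact (a + Suc b + k * l) :: rat)" by simp
  ultimately show "fact (Suc a + b + k * l) * fact (k * (l + 1)) / (fact (Suc a + k * l) * fact (b + k * l) * fact k)
      * (of_nat a + 1 + of_nat k * of_nat l)
    = fact (a + Suc b + k * l) * fact (k * (l + 1)) / (fact (a + k * l) * fact (Suc b + k * l) * fact k)
      * (of_nat b + 1 + of_nat k * of_nat l :: rat)"
    by (simp del: of_nat_Suc fact_Suc add_Suc add_Suc_right)
qed

lemma M_b_0: "M n a 0 k = M n 0 0 k"
  unfolding M_def by (intro prod.cong refl) (simp add: divide_simps)

lemma M_Suc: "M (Suc n) 0 0 k = M n k k k"
  unfolding M_def prod.lessThan_Suc_shift
  by (auto intro!: prod.cong simp: divide_simps algebra_simps)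

text \<open>
  The induction over \<open>S\<close> supplies the case \<open>a = b = 0\<close>, hence \<open>b = 0\<close>; the inner induction trades
  units of \<open>a\<close> for units of \<open>b\<close>. The closed form satisfies the same three reductions
  (\<open>M_shift\<close>, \<open>M_b_0\<close>, \<open>M_Suc\<close>).
\<close>

proposition morris_constant_term:
  assumes "finite S" "0 \<notin> S"
  shows "CT (weight a b k S) = M (card S) a b k"
  using assms
proof (induction S arbitrary: a b)
  case empty
  then show ?case by (simp add: weight_def offdiag_def M_def)
next
  case (insert m S)
  let ?S = "insert m S"
  have S: "finite ?S" "0 \<notin> ?S" using insert by auto
  show ?case
  proof (induction b arbitrary: a)
    case 0
    have "CT (weight a 0 k ?S) = CT (weight k k k S)"
      using insert CT_weight_b_0[OF S] by (simp add: CT_weight_insert)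
    also have "\<dots> = M (card ?S) a 0 k"
      using insert M_b_0[of "card ?S" a k] by (simp add: M_Suc)
    finally show ?case .
  next
    case (Suc b)
    define P where "P = (\<Prod>l<card ?S. of_nat b + 1 + of_nat k * of_nat l :: rat)"
    have "P \<noteq> 0"
      using prod_nat_pos_rat[of b k "card ?S"] by (simp only: P_def)
    moreover have "CT (weight a (Suc b) k ?S) * P = M (card ?S) a (Suc b) k * P"
      unfolding P_def CT_weight_shift[OF S, symmetric] M_shift[symmetric] Suc.IH ..
    ultimately show ?case by (metis mult_right_cancel)
  qed
qed

section \<open>Relations between moments in three variables\<close>

text \<open>
  The divided difference of \<open>y\<^sub>i\<^sup>z\<^sup>+\<^sup>d y\<^sub>j\<^sup>z\<close> is a geometric sum of \<open>d\<close> monomials. After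
  multiplication by \<open>y\<^sub>i + y\<^sub>j\<close>, the two resulting sums have the same moment by symmetry, which absorbs the
  factor \<open>2\<close>.
\<close>

lemma pair_moment_ypow:
  assumes S: "finite S" "0 \<notin> S" "i \<in> S" "j \<in> S" "i \<noteq> j" and f: "swap.subst i j f = f"
  shows "pair_moment a b k S i j (ypow i (z + int d) * ypow j z * f)
    = of_nat k * (\<Sum>t<d. moment a b k S (ypow i (z + int (Suc t)) * ypow j (z + int d - int (Suc t)) * f))"
    (is "?P = _")
proof -
  have ij: "i \<noteq> 0" "j \<noteq> 0" using S by metis+
  define Y where "Y t = ypow i (z + int t) * ypow j (z + int d - int t)" for t
  define X where "X t = ypow i (z + int t) * ypow j (z + int d - int (Suc t))" for t
  define q where "q = (\<Sum>t<d. X t) * f"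
  have 1: "ypow i 1 * X t = Y (Suc t)" for t
    using ypow_add[of i 1 "z + int t"] by (simp add: X_def Y_def add_ac mult.assoc)
  have 2: "ypow j 1 * X t = Y t" for t
  proof -
    have "1 + (z + int d - int (Suc t)) = z + int d - int t" by simp
    then show ?thesis
      using ypow_add[of j 1 "z + int d - int (Suc t)"]
      by (simp only: X_def Y_def mult.left_commute[of "ypow j 1"])
  qed
  have swap_Y: "swap.subst i j (Y t) = Y (d - t)" if "t \<le> d" for t
    using ij that by (simp add: Y_def swap.subst_mult swap_ypow of_nat_diff algebra_simps)
  have "ypow i (z + int d) * ypow j z * f - swap.subst i j (ypow i (z + int d) * ypow j z * f)
      = (Y d - Y 0) * f"
    using ij by (simp add: swap.subst_mult swap_ypow f Y_def algebra_simps)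
  also have "Y d - Y 0 = (\<Sum>t<d. Y (Suc t) - Y t)"
    by (rule sum_lessThan_telescope[symmetric])
  also have "\<dots> = (ypow i 1 - ypow j 1) * (\<Sum>t<d. X t)"
    by (simp only: sum_distrib_left left_diff_distrib 1 2)
  finally have "2 * ?P = of_nat k * moment a b k S ((ypow i 1 + ypow j 1) * q)"
    by (intro pair_moment_divided_difference S) (simp only: q_def mult.assoc)
  also have "(ypow i 1 + ypow j 1) * q = (\<Sum>t<d. Y (Suc t) * f) + (\<Sum>t<d. Y t * f)"
    by (simp only: q_def distrib_right sum.distrib sum_distrib_left sum_distrib_right mult.assoc[symmetric] 1 2)
  also have "moment a b k S \<dots> = (\<Sum>t<d. moment a b k S (Y (Suc t) * f)) + (\<Sum>t<d. moment a b k S (Y t * f))"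
    by (simp only: moment_add moment_sum)
  also have "(\<Sum>t<d. moment a b k S (Y t * f)) = (\<Sum>t<d. moment a b k S (Y (Suc (d - Suc t)) * f))"
  proof (intro sum.cong refl)
    fix t assume t: "t \<in> {..<d}"
    have "moment a b k S (Y t * f) = moment a b k S (swap.subst i j (Y t * f))"
      by (rule moment_swap[OF S(1-4), symmetric])
    also have "swap.subst i j (Y t * f) = Y (Suc (d - Suc t)) * f"
      using t by (simp add: swap.subst_mult f swap_Y Suc_diff_Suc)
    finally show "moment a b k S (Y t * f) = moment a b k S (Y (Suc (d - Suc t)) * f)" .
  qed
  also have "\<dots> = (\<Sum>t<d. moment a b k S (Y (Suc t) * f))"
    by (rule sum.nat_diff_reindex)
  finally show ?thesis
    unfolding Y_def distrib_left by linarith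
qed

lemma pair_moment_ypow':
  assumes S: "finite S" "0 \<notin> S" "i \<in> S" "j \<in> S" "i \<noteq> j" and f: "swap.subst i j f = f"
  shows "pair_moment a b k S i j (ypow i z * ypow j (z + int d) * f)
    = - of_nat k * (\<Sum>t<d. moment a b k S (ypow i (z + int (Suc t)) * ypow j (z + int d - int (Suc t)) * f))"
proof -
  have ij: "i \<noteq> 0" "j \<noteq> 0" using S by metis+
  have "ypow i z * ypow j (z + int d) * f = swap.subst i j (ypow i (z + int d) * ypow j z * f)"
    using ij by (simp add: swap.subst_mult swap_ypow f mult_ac)
  then have "pair_moment a b k S i j (ypow i z * ypow j (z + int d) * f)
      = - pair_moment a b k S i j (ypow i (z + int d) * ypow j z * f)"
    using S by (simp add: pair_moment_swap)
  then show ?thesis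
    by (simp only: pair_moment_ypow[OF assms] minus_mult_left)
qed

locale three_variables =
  fixes k :: nat and S :: "nat set" and u v w :: nat
  assumes finite_S: "finite S" and zero_S: "0 \<notin> S"
    and uvw: "u \<in> S" "v \<in> S" "w \<in> S" "u \<noteq> v" "u \<noteq> w" "v \<noteq> w"
begin

definition mom :: "nat \<Rightarrow> nat \<Rightarrow> int \<Rightarrow> int \<Rightarrow> int \<Rightarrow> rat"
  where "mom a b p q r = moment a b k S (ypow u p * ypow v q * ypow w r)"

lemma nonzero: "l \<in> S \<Longrightarrow> l \<noteq> 0"
  using zero_S by metis

lemma uvw_nonzero: "u \<noteq> 0" "v \<noteq> 0" "w \<noteq> 0"
  using nonzero uvw by blast+

lemma mom_swap12: "mom a b p q r = mom a b q p r"
proof -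
  have "mom a b p q r = moment a b k S (swap.subst u v (ypow u p * ypow v q * ypow w r))"
    unfolding mom_def by (rule moment_swap[OF finite_S zero_S uvw(1,2), symmetric])
  then show ?thesis
    using uvw uvw_nonzero
    by (simp add: mom_def swap.subst_mult swap_ypow transpose_apply_other mult_ac)
qed

lemma mom_swap23: "mom a b p q r = mom a b p r q"
proof -
  have "mom a b p q r = moment a b k S (swap.subst v w (ypow u p * ypow v q * ypow w r))"
    unfolding mom_def by (rule moment_swap[OF finite_S zero_S uvw(2,3), symmetric])
  then show ?thesis
    using uvw uvw_nonzero
    by (simp add: mom_def swap.subst_mult swap_ypow transpose_apply_other mult_ac)
qed

lemma mom_inversion: "mom a b (- p) (- q) (- r) = mom b a p q r"
  using moment_inversion[of a b k S "ypow u p * ypow v q * ypow w r"]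
  by (simp add: mom_def inversion.subst_mult inversion_ypow)

abbreviation pm12 where "pm12 a b p q r \<equiv> pair_moment a b k S u v (ypow u p * ypow v q * ypow w r)"

lemma swap_third: "swap.subst u v (ypow w r) = ypow w r"
  using uvw uvw_nonzero by (simp add: swap_ypow transpose_apply_other)

lemmas pm12_down = pair_moment_ypow[OF finite_S zero_S uvw(1,2,4) swap_third]
lemmas pm12_up = pair_moment_ypow'[OF finite_S zero_S uvw(1,2,4) swap_third]

lemma pm12_values:
  "pm12 a b 0 0 r = 0"
  "pm12 a b 1 0 r = of_nat k * mom a b 1 0 r"
  "pm12 a b 2 0 r = of_nat k * (mom a b 2 0 r + mom a b 1 1 r)"
  "pm12 a b 1 1 r = 0"
  "pm12 a b 0 1 r = - of_nat k * mom a b 1 0 r"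
  "pm12 a b 0 (- 1) r = of_nat k * mom a b 0 (- 1) r"
  "pm12 a b 1 (- 1) r = of_nat k * (mom a b 1 (- 1) r + mom a b 0 0 r)"
  "pm12 a b 0 (- 2) r = of_nat k * (mom a b 0 (- 2) r + mom a b (- 1) (- 1) r)"
  "pm12 a b 1 (- 2) r = of_nat k * (mom a b 1 (- 2) r + mom a b 0 (- 1) r + mom a b (- 1) 0 r)"
  "pm12 a b 2 (- 2) r = of_nat k * (mom a b 2 (- 2) r + mom a b 1 (- 1) r + mom a b 0 0 r + mom a b (- 1) 1 r)"
  using pm12_down[of a b k 0 0 r] pm12_down[of a b k 0 1 r] pm12_down[of a b k 0 2 r]
    pm12_down[of a b k 1 0 r] pm12_up[of a b k 0 1 r] pm12_down[of a b k "-1" 1 r]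
    pm12_down[of a b k "-1" 2 r] pm12_down[of a b k "-2" 2 r] pm12_down[of a b k "-2" 3 r]
    pm12_down[of a b k "-2" 4 r]
  by (simp_all add: mom_def eval_nat_numeral add_ac)

abbreviation pm13 where "pm13 a b p q r \<equiv> pair_moment a b k S u w (ypow u p * ypow w r * ypow v q)"

lemma pm13_values:
  "pm13 a b 0 q 0 = 0"
  "pm13 a b 1 q 0 = of_nat k * mom a b 1 q 0"
  "pm13 a b 1 q 1 = 0"
  "pm13 a b 0 q 1 = - of_nat k * mom a b 1 q 0"
  "pm13 a b 0 q (- 1) = of_nat k * mom a b 0 q (- 1)"
  "pm13 a b 1 q (- 1) = of_nat k * (mom a b 1 q (- 1) + mom a b 0 q 0)"
proof -
  interpret X: three_variables k S u w v
    using finite_S zero_S uvw by unfold_locales auto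
  have "X.mom a b p q r = mom a b p r q" for p q r
    by (simp add: X.mom_def mom_def mult_ac)
  then show
    "pm13 a b 0 q 0 = 0"
    "pm13 a b 1 q 0 = of_nat k * mom a b 1 q 0"
    "pm13 a b 1 q 1 = 0"
    "pm13 a b 0 q 1 = - of_nat k * mom a b 1 q 0"
    "pm13 a b 0 q (- 1) = of_nat k * mom a b 0 q (- 1)"
    "pm13 a b 1 q (- 1) = of_nat k * (mom a b 1 q (- 1) + mom a b 0 q 0)"
    by (simp_all only: X.pm12_values)
qed

lemma swap_ypow_other: "l \<in> S \<Longrightarrow> j \<in> S \<Longrightarrow> m \<noteq> l \<Longrightarrow> m \<noteq> j \<Longrightarrow> swap.subst l j (ypow m z) = ypow m z"
  using nonzero by (simp add: swap_ypow transpose_apply_other)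

text \<open>
  Integration by parts with \<open>g = y\<^sub>v\<^sup>q y\<^sub>w\<^sup>r\<close>. All variables other than \<open>x\<^sub>u, x\<^sub>v, x\<^sub>w\<close> contribute
  the same amount, so their number enters only as a coefficient and no further variable occurs.
\<close>

lemma recursion_linear:
  "(of_nat a + 1) * mom a b 1 q r + of_nat b * mom a b 0 q r
    + (pm12 a b 1 q r - pm12 a b 0 q r) + (pm13 a b 1 q r - pm13 a b 0 q r)
    + (of_nat (card S) - 3) * (of_nat k * mom a b 1 q r) = 0"
proof -
  define g where "g = ypow v q * ypow w r"
  \<comment> \<open>The summand is the same for all variables that do not occur in \<open>g\<close>.\<close>
  have pm: "pair_moment a b k S u j ((ypow u 1 - 1) * g) = of_nat k * mom a b 1 q r"
    if j: "j \<in> S - {u, v, w}" for j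
  proof -
    have g: "swap.subst u j g = g"
      using j uvw by (simp add: g_def swap.subst_mult swap_ypow_other)
    have "u \<noteq> j" "j \<in> S" using j by auto
    note * = pair_moment_ypow[OF finite_S zero_S uvw(1) this(2,1) g, of a b k 0]
    show ?thesis
      using *[of 0] *[of 1]
      by (simp add: left_diff_distrib pair_moment_diff mom_def g_def mult.assoc)
  qed
  have "card {u, v, w} = 3"
    using uvw by simp
  moreover have "card {u, v, w} + card (S - {u, v, w}) = card S"
    using uvw finite_S by (subst card_Un_disjoint[symmetric]) (auto intro!: arg_cong[of _ _ card])
  ultimately have card: "of_nat (card (S - {u, v, w})) = (of_nat (card S) - 3 :: rat)"
    by (simp flip: of_nat_add)
  have "(\<Sum>j\<in>S - {u}. pair_moment a b k S u j ((ypow u 1 - 1) * g))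
      = (\<Sum>j\<in>S - {u} - {v, w}. pair_moment a b k S u j ((ypow u 1 - 1) * g))
        + (\<Sum>j\<in>{v, w}. pair_moment a b k S u j ((ypow u 1 - 1) * g))"
    using uvw finite_S by (intro sum.subset_diff) auto
  also have "S - {u} - {v, w} = S - {u, v, w}"
    by auto
  also have "(\<Sum>j\<in>S - {u, v, w}. pair_moment a b k S u j ((ypow u 1 - 1) * g))
      = (of_nat (card S) - 3) * (of_nat k * mom a b 1 q r)"
    by (simp only: pm sum_constant card cong: sum.cong)
  also have "(\<Sum>j\<in>{v, w}. pair_moment a b k S u j ((ypow u 1 - 1) * g))
      = pair_moment a b k S u v ((ypow u 1 - 1) * g) + pair_moment a b k S u w ((ypow u 1 - 1) * g)"
    using uvw by simp
  also have "pair_moment a b k S u v ((ypow u 1 - 1) * g) = pm12 a b 1 q r - pm12 a b 0 q r"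
  proof -
    have "(ypow u 1 - 1) * g = ypow u 1 * ypow v q * ypow w r - ypow u 0 * ypow v q * ypow w r"
      by (simp add: g_def algebra_simps)
    then show ?thesis by (simp only: pair_moment_diff)
  qed
  also have "pair_moment a b k S u w ((ypow u 1 - 1) * g) = pm13 a b 1 q r - pm13 a b 0 q r"
  proof -
    have "(ypow u 1 - 1) * g = ypow u 1 * ypow w r * ypow v q - ypow u 0 * ypow w r * ypow v q"
      by (simp add: g_def algebra_simps)
    then show ?thesis by (simp only: pair_moment_diff)
  qed
  finally have sum: "(\<Sum>j\<in>S - {u}. pair_moment a b k S u j ((ypow u 1 - 1) * g))
      = (of_nat (card S) - 3) * (of_nat k * mom a b 1 q r)
      + ((pm12 a b 1 q r - pm12 a b 0 q r) + (pm13 a b 1 q r - pm13 a b 0 q r))" .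
  have "euler u ((ypow u 1 - 1) * g) = ypow u 1 * g"
    using uvw uvw_nonzero by (simp add: g_def euler_mult euler_diff euler_ypow_same euler_ypow_other)
  then have "moment a b k S (euler u ((ypow u 1 - 1) * g)) = mom a b 1 q r"
    by (simp add: mom_def g_def mult.assoc)
  moreover have "moment a b k S ((of_nat a * ypow u 1 + of_nat b) * g)
      = of_nat a * mom a b 1 q r + of_nat b * mom a b 0 q r"
    by (simp add: distrib_right mult.assoc moment_add moment_of_nat mom_def g_def)
  ultimately show ?thesis
    using integration_by_parts[OF finite_S zero_S uvw(1), of a b k g] unfolding sum
    by (simp only: distrib_right mult_1_left)
qed

text \<open>
  Integration by parts with \<open>g = y\<^sub>u y\<^sub>v\<^sup>q\<close>. Here a variable \<open>x\<^sub>j\<close> outside \<open>x\<^sub>u, x\<^sub>v\<close> leaves the monomial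
  \<open>y\<^sub>u y\<^sub>v\<^sup>q y\<^sub>j\<close>, whose moment does not depend on \<open>j\<close>; the third variable \<open>x\<^sub>w\<close> stands in for it.
\<close>

lemma recursion_quadratic:
  "(of_nat a + 2) * mom a b 2 q 0 + (of_nat b - 1) * mom a b 1 q 0
    + (pm12 a b 2 q 0 - pm12 a b 1 q 0)
    + (of_nat (card S) - 2) * (of_nat k * (mom a b 2 q 0 + mom a b 1 q 1 - mom a b 1 q 0)) = 0"
proof -
  define f where "f = ypow v q"
  define g where "g = ypow u 1 * f"
  have y2: "ypow u 2 = ypow u 1 * ypow u 1"
    by (simp flip: ypow_add)
  have g2: "(ypow u 1 - 1) * g = ypow u 2 * f - ypow u 1 * f"
    by (simp add: g_def y2 left_diff_distrib mult.assoc)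
  have pm: "pair_moment a b k S u j ((ypow u 1 - 1) * g)
      = of_nat k * (mom a b 2 q 0 + mom a b 1 q 1 - mom a b 1 q 0)"
    if j: "j \<in> S - {u, v}" for j
  proof -
    have f: "swap.subst u j f = f"
      using j uvw by (simp add: f_def swap_ypow_other)
    have "u \<noteq> j" "j \<in> S" using j by auto
    note * = pair_moment_ypow[OF finite_S zero_S uvw(1) this(2,1) f, of a b k 0]
    \<comment> \<open>Exchanging \<open>x\<^sub>j\<close> with \<open>x\<^sub>w\<close> brings the moment into the standard variables; \<open>j = w\<close> is allowed.\<close>
    have "moment a b k S (ypow u 1 * ypow j 1 * f)
        = moment a b k S (swap.subst w j (ypow u 1 * ypow j 1 * f))"
      using \<open>j \<in> S\<close> uvw by (intro moment_swap[symmetric] finite_S zero_S)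
    also have "swap.subst w j (ypow u 1 * ypow j 1 * f) = ypow u 1 * ypow v q * ypow w 1"
      using j uvw nonzero by (simp add: swap.subst_mult swap_ypow_other f_def mult_ac swap_ypow)
    finally have "moment a b k S (ypow u 1 * ypow j 1 * f) = mom a b 1 q 1"
      by (simp only: mom_def)
    then show ?thesis
      using *[of 1] *[of 2] unfolding g2
      by (simp add: pair_moment_diff mom_def f_def eval_nat_numeral algebra_simps)
  qed
  have "card {u, v} = 2"
    using uvw by simp
  moreover have "card {u, v} + card (S - {u, v}) = card S"
    using uvw finite_S by (subst card_Un_disjoint[symmetric]) (auto intro!: arg_cong[of _ _ card])
  ultimately have card: "of_nat (card (S - {u, v})) = (of_nat (card S) - 2 :: rat)"
    by (simp flip: of_nat_add)
  have "(\<Sum>j\<in>S - {u}. pair_moment a b k S u j ((ypow u 1 - 1) * g))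
      = (\<Sum>j\<in>S - {u} - {v}. pair_moment a b k S u j ((ypow u 1 - 1) * g))
        + (\<Sum>j\<in>{v}. pair_moment a b k S u j ((ypow u 1 - 1) * g))"
    using uvw finite_S by (intro sum.subset_diff) auto
  also have "S - {u} - {v} = S - {u, v}"
    by auto
  also have "(\<Sum>j\<in>S - {u, v}. pair_moment a b k S u j ((ypow u 1 - 1) * g))
      = (of_nat (card S) - 2) * (of_nat k * (mom a b 2 q 0 + mom a b 1 q 1 - mom a b 1 q 0))"
    by (simp only: pm sum_constant card cong: sum.cong)
  also have "(\<Sum>j\<in>{v}. pair_moment a b k S u j ((ypow u 1 - 1) * g))
      = pm12 a b 2 q 0 - pm12 a b 1 q 0"
    unfolding g2 by (simp add: f_def pair_moment_diff)
  finally have sum: "(\<Sum>j\<in>S - {u}. pair_moment a b k S u j ((ypow u 1 - 1) * g))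
      = (of_nat (card S) - 2) * (of_nat k * (mom a b 2 q 0 + mom a b 1 q 1 - mom a b 1 q 0))
      + (pm12 a b 2 q 0 - pm12 a b 1 q 0)" .
  have "euler u ((ypow u 1 - 1) * g) = 2 * (ypow u 2 * f) - ypow u 1 * f"
    unfolding g2 using uvw uvw_nonzero
    by (simp add: f_def euler_mult euler_diff euler_ypow_same euler_ypow_other mult.assoc)
  then have "moment a b k S (euler u ((ypow u 1 - 1) * g)) = 2 * mom a b 2 q 0 - mom a b 1 q 0"
    by (simp add: mom_def f_def moment_diff moment_numeral)
  moreover have "(of_nat a * ypow u 1 + of_nat b) * g = of_nat a * (ypow u 2 * f) + of_nat b * (ypow u 1 * f)"
    by (simp add: g_def y2 distrib_right mult.assoc)
  then have "moment a b k S ((of_nat a * ypow u 1 + of_nat b) * g)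
      = of_nat a * mom a b 2 q 0 + of_nat b * mom a b 1 q 0"
    by (simp add: moment_add moment_of_nat mom_def f_def)
  ultimately show ?thesis
    using integration_by_parts[OF finite_S zero_S uvw(1), of a b k g] unfolding sum
    by (simp only: distrib_right left_diff_distrib mult_1_left)
qed

definition K :: rat where "K = of_nat k * (of_nat (card S) - 1)"

text \<open>
  The first three relations determine the moments with positive exponents from \<open>[0,0,0]\<close>. Inversion of
  the variables carries them to negative exponents, with \<open>a\<close> and \<open>b\<close> exchanged, and then the
  remaining five relations determine the mixed moments one after the other.
\<close>

lemma mom_relations:
  fixes a b :: nat
  defines "A \<equiv> of_nat a :: rat" and "B \<equiv> of_nat b :: rat" and "\<kappa> \<equiv> of_nat k :: rat"
  shows
    "(1 + A + K) * mom a b 1 0 0 + B * mom a b 0 0 0 = 0"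
    "(1 + A + K - \<kappa>) * mom a b 1 1 0 + (B + \<kappa>) * mom a b 1 0 0 = 0"
    "(2 + A + K) * mom a b 2 0 0 + (B - 1) * mom a b 1 0 0 + K * (mom a b 1 1 0 - mom a b 1 0 0) = 0"
    "(1 + A + K) * mom a b 1 (- 1) 0 + (B - \<kappa>) * mom a b (- 1) 0 0 + \<kappa> * mom a b 0 0 0 = 0"
    "(1 + A + K) * mom a b 1 (- 1) (- 1) + (B - 2 * \<kappa>) * mom a b (- 1) (- 1) 0
      + 2 * \<kappa> * mom a b (- 1) 0 0 = 0"
    "(1 + A + K) * mom a b 1 (- 2) 0 + (B - \<kappa>) * mom a b (- 2) 0 0 + 2 * \<kappa> * mom a b (- 1) 0 0
      - \<kappa> * mom a b (- 1) (- 1) 0 = 0"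
    "(1 + A + K - \<kappa>) * mom a b 1 1 (- 2) + B * mom a b 1 (- 2) 0 + 2 * \<kappa> * mom a b 1 (- 1) 0
      - \<kappa> * mom a b 1 (- 1) (- 1) = 0"
    "(2 + A + K) * mom a b 2 (- 2) 0 + (B - 1 - K) * mom a b 1 (- 2) 0
      + \<kappa> * (2 * mom a b 1 (- 1) 0 + mom a b 0 0 0) - 2 * \<kappa> * mom a b (- 1) 0 0
      + (K - \<kappa>) * mom a b 1 1 (- 2) = 0"
proof -
  have sym: "mom a b 0 1 0 = mom a b 1 0 0" "mom a b 0 (- 1) 0 = mom a b (- 1) 0 0"
    "mom a b 0 (- 2) 0 = mom a b (- 2) 0 0" "mom a b 0 0 (- 1) = mom a b (- 1) 0 0"
    "mom a b 0 (- 2) 1 = mom a b 1 (- 2) 0" "mom a b 0 (- 1) 1 = mom a b 1 (- 1) 0"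
    "mom a b (- 1) 0 1 = mom a b 1 (- 1) 0" "mom a b (- 1) 1 0 = mom a b 1 (- 1) 0"
    "mom a b 0 (- 1) (- 1) = mom a b (- 1) (- 1) 0" "mom a b 1 0 (- 1) = mom a b 1 (- 1) 0" "mom a b 1 0 1 = mom a b 1 1 0"
    "mom a b 1 (- 2) 1 = mom a b 1 1 (- 2)" "mom a b (- 1) (- 1) 1 = mom a b 1 (- 1) (- 1)"
    using mom_swap12 mom_swap23 by metis+
  note vals = pm12_values pm13_values sym A_def B_def \<kappa>_def K_def
  show "(1 + A + K) * mom a b 1 0 0 + B * mom a b 0 0 0 = 0"
    using recursion_linear[of a b 0 0] unfolding vals by (simp add: algebra_simps)
  show "(1 + A + K - \<kappa>) * mom a b 1 1 0 + (B + \<kappa>) * mom a b 1 0 0 = 0"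
    using recursion_linear[of a b 1 0] unfolding vals by (simp add: algebra_simps)
  show "(2 + A + K) * mom a b 2 0 0 + (B - 1) * mom a b 1 0 0 + K * (mom a b 1 1 0 - mom a b 1 0 0) = 0"
    using recursion_quadratic[of a b 0] unfolding vals by (simp add: algebra_simps)
  show "(1 + A + K) * mom a b 1 (- 1) 0 + (B - \<kappa>) * mom a b (- 1) 0 0 + \<kappa> * mom a b 0 0 0 = 0"
    using recursion_linear[of a b "-1" 0] unfolding vals by (simp add: algebra_simps)
  show "(1 + A + K) * mom a b 1 (- 1) (- 1) + (B - 2 * \<kappa>) * mom a b (- 1) (- 1) 0
      + 2 * \<kappa> * mom a b (- 1) 0 0 = 0"
    using recursion_linear[of a b "-1" "-1"] unfolding vals by (simp add: algebra_simps)
  show "(1 + A + K) * mom a b 1 (- 2) 0 + (B - \<kappa>) * mom a b (- 2) 0 0 + 2 * \<kappa> * mom a b (- 1) 0 0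
      - \<kappa> * mom a b (- 1) (- 1) 0 = 0"
    using recursion_linear[of a b "-2" 0] unfolding vals by (simp add: algebra_simps)
  show "(1 + A + K - \<kappa>) * mom a b 1 1 (- 2) + B * mom a b 1 (- 2) 0 + 2 * \<kappa> * mom a b 1 (- 1) 0
      - \<kappa> * mom a b 1 (- 1) (- 1) = 0"
    using recursion_linear[of a b "-2" 1] unfolding vals by (simp add: algebra_simps)
  show "(2 + A + K) * mom a b 2 (- 2) 0 + (B - 1 - K) * mom a b 1 (- 2) 0
      + \<kappa> * (2 * mom a b 1 (- 1) 0 + mom a b 0 0 0) - 2 * \<kappa> * mom a b (- 1) 0 0
      + (K - \<kappa>) * mom a b 1 1 (- 2) = 0"
    using recursion_quadratic[of a b "-2"] unfolding vals by (simp add: algebra_simps)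
qed

end

section \<open>Solving the relations\<close>

text \<open>
  These are the numerators of the moments \<open>[1,-1,0]\<close>, \<open>[1,-1,-1]\<close>, \<open>[1,-2,0]\<close> and \<open>[1,1,-2]\<close> divided by
  \<open>[0,0,0]\<close>; the denominators are the linear factors by which the next lemma and its proof multiply
  these moments. The letters stand for \<open>\<kappa> = k\<close>, \<open>K = k (n - 1)\<close>, \<open>A = a\<close> and \<open>B = b\<close>.
\<close>

definition num_pp :: "rat \<Rightarrow> rat \<Rightarrow> rat \<Rightarrow> rat \<Rightarrow> rat"
  where "num_pp \<kappa> K A B = A * B - \<kappa> * (1 + A + B + K)"

definition num_pnn :: "rat \<Rightarrow> rat \<Rightarrow> rat \<Rightarrow> rat \<Rightarrow> rat"
  where "num_pnn \<kappa> K A B = - A * ((B - 2 * \<kappa>) * (A + \<kappa>) - 2 * \<kappa> * (1 + B + K - \<kappa>))"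

definition num_pn2 :: "rat \<Rightarrow> rat \<Rightarrow> rat \<Rightarrow> rat \<Rightarrow> rat"
  where "num_pn2 \<kappa> K A B =
    - A * ((B - \<kappa>) * ((A - 1 - K) * (1 + B + K - \<kappa>) - K * (A + \<kappa>))
           - 2 * \<kappa> * (1 + B + K - \<kappa>) * (2 + B + K) - \<kappa> * (A + \<kappa>) * (2 + B + K))"

definition num_ppn2 :: "rat \<Rightarrow> rat \<Rightarrow> rat \<Rightarrow> rat \<Rightarrow> rat"
  where "num_ppn2 \<kappa> K A B =
    - (B * num_pn2 \<kappa> K A B + 2 * \<kappa> * num_pp \<kappa> K A B * (1 + B + K - \<kappa>) * (2 + B + K)
       - \<kappa> * num_pnn \<kappa> K A B * (2 + B + K))"

text \<open>
  Back substitution in the triangular system. Here \<open>m = [0,0,0]\<close>, while \<open>n1, n11, n2\<close> are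
  \<open>[-1,0,0], [-1,-1,0], [-2,0,0]\<close>, and \<open>P, X, Y, Q, D\<close> are
  \<open>[1,-1,0], [1,-1,-1], [1,-2,0], [1,1,-2], [2,-2,0]\<close>. Each relation is multiplied by the denominators met so far,
  which keeps the computation polynomial.
\<close>

lemma solve_relations:
  fixes \<kappa> K A B m n1 n11 n2 P X Y Q D :: rat
  assumes n1: "(1 + B + K) * n1 + A * m = 0"
    and n11: "(1 + B + K - \<kappa>) * n11 + (A + \<kappa>) * n1 = 0"
    and n2: "(2 + B + K) * n2 + (A - 1) * n1 + K * (n11 - n1) = 0"
    and P: "(1 + A + K) * P + (B - \<kappa>) * n1 + \<kappa> * m = 0"
    and X: "(1 + A + K) * X + (B - 2 * \<kappa>) * n11 + 2 * \<kappa> * n1 = 0"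
    and Y: "(1 + A + K) * Y + (B - \<kappa>) * n2 + 2 * \<kappa> * n1 - \<kappa> * n11 = 0"
    and Q: "(1 + A + K - \<kappa>) * Q + B * Y + 2 * \<kappa> * P - \<kappa> * X = 0"
    and D: "(2 + A + K) * D + (B - 1 - K) * Y + \<kappa> * (2 * P + m) - 2 * \<kappa> * n1 + (K - \<kappa>) * Q = 0"
  defines "s \<equiv> 1 + A + K" and "t \<equiv> 1 + B + K" and "s2 \<equiv> 2 + A + K" and "t2 \<equiv> 2 + B + K"
    and "sk \<equiv> 1 + A + K - \<kappa>" and "tk \<equiv> 1 + B + K - \<kappa>"
  shows "s * t * P = m * num_pp \<kappa> K A B"
    and "s * sk * t * tk * t2 * Q = m * num_ppn2 \<kappa> K A B"
    and "s * s2 * sk * t * t2 * tk * D = - m * ((B - 1 - K) * num_pn2 \<kappa> K A B * sk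
      + \<kappa> * (2 * num_pp \<kappa> K A B + s * t) * sk * tk * t2
      + 2 * \<kappa> * A * s * sk * tk * t2 + (K - \<kappa>) * num_ppn2 \<kappa> K A B)"
proof -
  have 1: "t * n1 = - A * m"
    using n1 unfolding t_def by algebra
  have 2: "t * tk * n11 = m * (A * (A + \<kappa>))"
    using 1 n11 unfolding tk_def by algebra
  have 3: "t * tk * t2 * n2 = m * (A * ((A - 1 - K) * tk - K * (A + \<kappa>)))"
  proof -
    have "t * tk * t2 * n2 = - (A - 1 - K) * tk * (t * n1) - K * (t * tk * n11)"
      using n2 unfolding t2_def by algebra
    then show ?thesis unfolding 1 2 by algebra
  qed
  show 4: "s * t * P = m * num_pp \<kappa> K A B"
  proof -
    have "s * t * P = - (B - \<kappa>) * (t * n1) - \<kappa> * t * m"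
      using P unfolding s_def by algebra
    then show ?thesis using 1 unfolding num_pp_def t_def by algebra
  qed
  have 5: "s * t * tk * X = m * num_pnn \<kappa> K A B"
  proof -
    have "s * t * tk * X = - (B - 2 * \<kappa>) * (t * tk * n11) - 2 * \<kappa> * tk * (t * n1)"
      using X unfolding s_def by algebra
    then show ?thesis unfolding 1 2 num_pnn_def tk_def[symmetric] by algebra
  qed
  have 6: "s * t * tk * t2 * Y = m * num_pn2 \<kappa> K A B"
  proof -
    have "s * t * tk * t2 * Y = - (B - \<kappa>) * (t * tk * t2 * n2) - 2 * \<kappa> * tk * t2 * (t * n1)
        + \<kappa> * t2 * (t * tk * n11)"
      using Y unfolding s_def by algebra
    then show ?thesis unfolding 1 2 3 num_pn2_def tk_def[symmetric] t2_def[symmetric] by algebra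
  qed
  show 7: "s * sk * t * tk * t2 * Q = m * num_ppn2 \<kappa> K A B"
  proof -
    have "s * sk * t * tk * t2 * Q
        = - (B * (s * t * tk * t2 * Y) + 2 * \<kappa> * tk * t2 * (s * t * P) - \<kappa> * t2 * (s * t * tk * X))"
      using Q unfolding sk_def by algebra
    then show ?thesis unfolding 4 5 6 num_ppn2_def tk_def[symmetric] t2_def[symmetric] by algebra
  qed
  have "s * s2 * sk * t * t2 * tk * D
      = - ((B - 1 - K) * sk * (s * t * tk * t2 * Y)
           + \<kappa> * sk * tk * t2 * (2 * (s * t * P) + s * t * m)
           - 2 * \<kappa> * s * sk * tk * t2 * (t * n1) + (K - \<kappa>) * (s * sk * t * tk * t2 * Q))"
    using D unfolding s2_def by algebra
  then show "s * s2 * sk * t * t2 * tk * D = - m * ((B - 1 - K) * num_pn2 \<kappa> K A B * sk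
      + \<kappa> * (2 * num_pp \<kappa> K A B + s * t) * sk * tk * t2
      + 2 * \<kappa> * A * s * sk * tk * t2 + (K - \<kappa>) * num_ppn2 \<kappa> K A B)"
    unfolding 1 4 6 7 by algebra
qed

text \<open>
  The point where the product formula emerges: over the common denominator, the combination of the
  moments has a numerator that splits into linear factors.
\<close>

lemma numerator_identity:
  fixes A B \<kappa> K :: rat
  defines "s \<equiv> 1 + A + K" and "t \<equiv> 1 + B + K" and "s2 \<equiv> 2 + A + K" and "t2 \<equiv> 2 + B + K"
    and "sk \<equiv> 1 + A + K - \<kappa>" and "tk \<equiv> 1 + B + K - \<kappa>"
  shows "s * s2 * sk * t * t2 * tk - 2 * num_pp \<kappa> K A B * s2 * sk * t2 * tk
      + num_ppn2 \<kappa> K A B * s2 + num_ppn2 \<kappa> K B A * t2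
      + ((B - 1 - K) * num_pn2 \<kappa> K A B * sk
         + \<kappa> * (2 * num_pp \<kappa> K A B + s * t) * sk * tk * t2
         + 2 * \<kappa> * A * s * sk * tk * t2 + (K - \<kappa>) * num_ppn2 \<kappa> K A B)
    = (A + B + K - \<kappa> + 1) * (K + 1) * (A + B + K + 1) * (A + B + K + 2) * (K + \<kappa> + 1) * (K + \<kappa> + 2)"
  unfolding s_def t_def s2_def t2_def sk_def tk_def num_ppn2_def num_pn2_def num_pp_def num_pnn_def
  by algebra

lemma combination_identity:
  fixes A B \<kappa> K m P Q Q' D :: rat
  defines "s \<equiv> 1 + A + K" and "t \<equiv> 1 + B + K" and "s2 \<equiv> 2 + A + K" and "t2 \<equiv> 2 + B + K"
    and "sk \<equiv> 1 + A + K - \<kappa>" and "tk \<equiv> 1 + B + K - \<kappa>"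
  assumes P: "s * t * P = m * num_pp \<kappa> K A B"
    and Q: "s * sk * t * tk * t2 * Q = m * num_ppn2 \<kappa> K A B"
    and Q': "t * tk * s * sk * s2 * Q' = m * num_ppn2 \<kappa> K B A"
    and D: "s * s2 * sk * t * t2 * tk * D = - m * ((B - 1 - K) * num_pn2 \<kappa> K A B * sk
      + \<kappa> * (2 * num_pp \<kappa> K A B + s * t) * sk * tk * t2
      + 2 * \<kappa> * A * s * sk * tk * t2 + (K - \<kappa>) * num_ppn2 \<kappa> K A B)"
  shows "s * s2 * sk * t * t2 * tk * (m - 2 * P + Q + Q' - D)
    = m * ((A + B + K - \<kappa> + 1) * (K + 1) * (A + B + K + 1) * (A + B + K + 2) * (K + \<kappa> + 1) * (K + \<kappa> + 2))"
proof -
  have "s * s2 * sk * t * t2 * tk * (m - 2 * P + Q + Q' - D)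
      = s * s2 * sk * t * t2 * tk * m - 2 * s2 * sk * t2 * tk * (s * t * P)
        + s2 * (s * sk * t * tk * t2 * Q) + t2 * (t * tk * s * sk * s2 * Q') - s * s2 * sk * t * t2 * tk * D"
    by algebra
  also have "\<dots> = m * (s * s2 * sk * t * t2 * tk - 2 * num_pp \<kappa> K A B * s2 * sk * t2 * tk
      + num_ppn2 \<kappa> K A B * s2 + num_ppn2 \<kappa> K B A * t2
      + ((B - 1 - K) * num_pn2 \<kappa> K A B * sk
         + \<kappa> * (2 * num_pp \<kappa> K A B + s * t) * sk * tk * t2
         + 2 * \<kappa> * A * s * sk * tk * t2 + (K - \<kappa>) * num_ppn2 \<kappa> K A B))"
    unfolding P Q Q' D by algebra
  finally show ?thesis
    unfolding s_def t_def s2_def t2_def sk_def tk_def numerator_identity .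
qed

section \<open>Three heavy variables\<close>

context three_variables
begin

definition mon :: "int \<Rightarrow> int \<Rightarrow> int \<Rightarrow> laurent"
  where "mon p q r = ypow u p * ypow v q * ypow w r"

lemma mon_mult: "mon p q r * mon p' q' r' = mon (p + p') (q + q') (r + r')"
  by (simp only: mon_def ypow_add mult_ac)

text \<open>
  The product of the six factors \<open>1 - x\<^sub>i / x\<^sub>j\<close> expands into monomials of degree \<open>0\<close>, and those that
  differ by a permutation of the three variables have equal moments.
\<close>

lemma moment_pair_factors:
  "moment a b k S (pair_factor u v * pair_factor u w * pair_factor v w)
    = 6 * (mom a b 0 0 0 - 2 * mom a b 1 (- 1) 0 + mom a b 1 1 (- 2) + mom a b 2 (- 1) (- 1)
           - mom a b 2 (- 2) 0)"
proof -
  have "var_ratio l m * var_ratio m l = 1" for l m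
    by (simp add: var_ratio_def mult_single)
  then have "pair_factor l m = 1 + 1 - var_ratio l m - var_ratio m l" for l m
    by (simp add: pair_factor_def algebra_simps)
  then have pairs: "pair_factor u v = mon 0 0 0 + mon 0 0 0 - mon 1 (- 1) 0 - mon (- 1) 1 0"
    "pair_factor u w = mon 0 0 0 + mon 0 0 0 - mon 1 0 (- 1) - mon (- 1) 0 1"
    "pair_factor v w = mon 0 0 0 + mon 0 0 0 - mon 0 1 (- 1) - mon 0 (- 1) 1"
    by (simp_all add: mon_def var_ratio_eq_ypow mult.commute)
  have mom: "moment a b k S (mon p q r) = mom a b p q r" for p q r
    by (simp add: mom_def mon_def)
  have sym: "mom a b (- 1) 1 0 = mom a b 1 (- 1) 0" "mom a b 1 0 (- 1) = mom a b 1 (- 1) 0"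
    "mom a b (- 1) 0 1 = mom a b 1 (- 1) 0" "mom a b 0 1 (- 1) = mom a b 1 (- 1) 0"
    "mom a b 0 (- 1) 1 = mom a b 1 (- 1) 0"
    "mom a b 1 (- 2) 1 = mom a b 1 1 (- 2)" "mom a b (- 2) 1 1 = mom a b 1 1 (- 2)"
    "mom a b (- 1) 2 (- 1) = mom a b 2 (- 1) (- 1)" "mom a b (- 1) (- 1) 2 = mom a b 2 (- 1) (- 1)"
    "mom a b 2 0 (- 2) = mom a b 2 (- 2) 0" "mom a b (- 2) 2 0 = mom a b 2 (- 2) 0"
    "mom a b (- 2) 0 2 = mom a b 2 (- 2) 0" "mom a b 0 2 (- 2) = mom a b 2 (- 2) 0"
    "mom a b 0 (- 2) 2 = mom a b 2 (- 2) 0"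
    using mom_swap12 mom_swap23 by metis+
  show ?thesis
    unfolding pairs
    by (simp only: distrib_left distrib_right left_diff_distrib right_diff_distrib mon_mult
        moment_add moment_diff mom) (simp add: sym)
qed

lemma mom_closed_forms:
  fixes a b :: nat
  defines "A \<equiv> of_nat a :: rat" and "B \<equiv> of_nat b :: rat" and "\<kappa> \<equiv> of_nat k :: rat"
  shows "(1 + A + K) * (1 + B + K) * mom a b 1 (- 1) 0 = mom a b 0 0 0 * num_pp \<kappa> K A B"
    and "(1 + A + K) * (1 + A + K - \<kappa>) * (1 + B + K) * (1 + B + K - \<kappa>) * (2 + B + K) * mom a b 1 1 (- 2)
      = mom a b 0 0 0 * num_ppn2 \<kappa> K A B"
    and "(1 + A + K) * (2 + A + K) * (1 + A + K - \<kappa>) * (1 + B + K) * (2 + B + K) * (1 + B + K - \<kappa>)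
        * mom a b 2 (- 2) 0
      = - mom a b 0 0 0 * ((B - 1 - K) * num_pn2 \<kappa> K A B * (1 + A + K - \<kappa>)
      + \<kappa> * (2 * num_pp \<kappa> K A B + (1 + A + K) * (1 + B + K)) * (1 + A + K - \<kappa>) * (1 + B + K - \<kappa>) * (2 + B + K)
      + 2 * \<kappa> * A * (1 + A + K) * (1 + A + K - \<kappa>) * (1 + B + K - \<kappa>) * (2 + B + K)
      + (K - \<kappa>) * num_ppn2 \<kappa> K A B)"
proof -
  have inv: "mom b a p q r = mom a b (- p) (- q) (- r)" for p q r
    using mom_inversion[of a b p q r] by simp
  note ab = mom_relations[of a b, folded A_def B_def \<kappa>_def]
  note ba = mom_relations[of b a, folded A_def B_def \<kappa>_def]
  note solve = solve_relations[OF ba(1,2,3)[unfolded inv minus_zero] ab(4,5,6,7,8)]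
  show "(1 + A + K) * (1 + B + K) * mom a b 1 (- 1) 0 = mom a b 0 0 0 * num_pp \<kappa> K A B"
    by (rule solve(1))
  show "(1 + A + K) * (1 + A + K - \<kappa>) * (1 + B + K) * (1 + B + K - \<kappa>) * (2 + B + K) * mom a b 1 1 (- 2)
      = mom a b 0 0 0 * num_ppn2 \<kappa> K A B"
    by (rule solve(2))
  show "(1 + A + K) * (2 + A + K) * (1 + A + K - \<kappa>) * (1 + B + K) * (2 + B + K) * (1 + B + K - \<kappa>)
        * mom a b 2 (- 2) 0
      = - mom a b 0 0 0 * ((B - 1 - K) * num_pn2 \<kappa> K A B * (1 + A + K - \<kappa>)
      + \<kappa> * (2 * num_pp \<kappa> K A B + (1 + A + K) * (1 + B + K)) * (1 + A + K - \<kappa>) * (1 + B + K - \<kappa>) * (2 + B + K)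
      + 2 * \<kappa> * A * (1 + A + K) * (1 + A + K - \<kappa>) * (1 + B + K - \<kappa>) * (2 + B + K)
      + (K - \<kappa>) * num_ppn2 \<kappa> K A B)"
    by (rule solve(3))
qed

text \<open>
  The moment \<open>[2,-1,-1]\<close> is the value of \<open>[1,1,-2]\<close> with \<open>a\<close> and \<open>b\<close> exchanged, so all five moments
  are covered by the closed forms.
\<close>

proposition heavy_triple_average:
  fixes a b :: nat
  defines "A \<equiv> of_nat a :: rat" and "B \<equiv> of_nat b :: rat" and "\<kappa> \<equiv> of_nat k :: rat"
  shows "(1 + A + K) * (2 + A + K) * (1 + A + K - \<kappa>) * (1 + B + K) * (2 + B + K) * (1 + B + K - \<kappa>)
      * moment a b k S (pair_factor u v * pair_factor u w * pair_factor v w)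
    = 6 * (mom a b 0 0 0 * ((A + B + K - \<kappa> + 1) * (K + 1) * (A + B + K + 1) * (A + B + K + 2)
        * (K + \<kappa> + 1) * (K + \<kappa> + 2)))"
proof -
  have inv: "mom b a 0 0 0 = mom a b 0 0 0" "mom b a 1 1 (- 2) = mom a b 2 (- 1) (- 1)"
    using mom_inversion[of a b 0 0 0] mom_inversion[of a b 1 1 "-2"] mom_swap12 mom_swap23
    by (simp, metis minus_minus)
  note ab = mom_closed_forms[of a b, folded A_def B_def \<kappa>_def]
  note ba = mom_closed_forms(2)[of b a, folded A_def B_def \<kappa>_def, unfolded inv]
  show ?thesis
    unfolding moment_pair_factors
    using combination_identity[OF ab(1,2) ba ab(3)] by (simp only: mult.left_commute[of _ 6])
qed

end

text \<open>
  The bookkeeping that combines Morris' product with the average. For each of the last two indices of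
  Morris' product, the letters \<open>g, h, p, q\<close> stand for its four factorials that depend on the index,
  and \<open>s, r, d, e\<close> for the linear factors that raise the arguments of these factorials.
\<close>

lemma cancel_denominators:
  fixes X :: rat
  assumes "d\<^sub>2 * d\<^sub>3 * d\<^sub>1 * e\<^sub>2 * e\<^sub>3 * e\<^sub>1 * X
      = 6 * (m * F * (g\<^sub>1 * h\<^sub>1 / (p\<^sub>1 * q\<^sub>1 * c)) * (g\<^sub>2 * h\<^sub>2 / (p\<^sub>2 * q\<^sub>2 * c))
        * (s\<^sub>1 * r\<^sub>1 * s\<^sub>2 * s\<^sub>3 * r\<^sub>2 * r\<^sub>3))"
    and "d\<^sub>1 \<noteq> 0" "d\<^sub>2 \<noteq> 0" "d\<^sub>3 \<noteq> 0" "e\<^sub>1 \<noteq> 0" "e\<^sub>2 \<noteq> 0" "e\<^sub>3 \<noteq> 0"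
  shows "X = m * (F * (2 * (s\<^sub>1 * g\<^sub>1) * (r\<^sub>1 * h\<^sub>1) / (d\<^sub>1 * p\<^sub>1 * (e\<^sub>1 * q\<^sub>1) * c))
      * (3 * (s\<^sub>3 * (s\<^sub>2 * g\<^sub>2)) * (r\<^sub>3 * (r\<^sub>2 * h\<^sub>2)) / (d\<^sub>3 * (d\<^sub>2 * p\<^sub>2) * (e\<^sub>3 * (e\<^sub>2 * q\<^sub>2)) * c)))"
proof -
  have "X = 6 * (m * F * (g\<^sub>1 * h\<^sub>1 / (p\<^sub>1 * q\<^sub>1 * c)) * (g\<^sub>2 * h\<^sub>2 / (p\<^sub>2 * q\<^sub>2 * c))
        * (s\<^sub>1 * r\<^sub>1 * s\<^sub>2 * s\<^sub>3 * r\<^sub>2 * r\<^sub>3)) / (d\<^sub>2 * d\<^sub>3 * d\<^sub>1 * e\<^sub>2 * e\<^sub>3 * e\<^sub>1)"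
    unfolding assms(1)[symmetric] using assms(2-) by simp
  then show ?thesis by (simp add: mult_ac)
qed

theorem corollary5p6:
  fixes n\<^sub>0 n\<^sub>1 n a b k :: nat
  assumes "n\<^sub>1 = 3" and "n = n\<^sub>0 + n\<^sub>1"
  shows "CT ((\<Prod>(i, j)\<in>offdiag {n\<^sub>0 + 1..n}. 1 - var_ratio i j)
           * (\<Prod>l=1..n. (1 - var_ratio l 0) ^ a * (1 - var_ratio 0 l) ^ b)
           * (\<Prod>(i, j)\<in>offdiag {1..n}. (1 - var_ratio i j) ^ k))
       = M n\<^sub>0 a b k *
         (\<Prod>j<n\<^sub>1. of_nat (j + 1) * fact ((k + 1) * j + a + b + k * n\<^sub>0) * fact (k * j + k + j + k * n\<^sub>0)
                  / (fact k * fact ((k + 1) * j + a + k * n\<^sub>0) * fact ((k + 1) * j + b + k * n\<^sub>0)))"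
proof -
  define u v w where "u = n\<^sub>0 + 1" and "v = n\<^sub>0 + 2" and "w = n\<^sub>0 + 3"
  have n: "n = n\<^sub>0 + 3" using assms by simp
  interpret three_variables k "{1..n}" u v w
    by unfold_locales (auto simp: u_def v_def w_def n)
  have "{n\<^sub>0 + 1..n} = insert u (insert v (insert w {}))"
    by (auto simp: n u_def v_def w_def)
  then have heavy: "(\<Prod>(i, j)\<in>offdiag {n\<^sub>0 + 1..n}. 1 - var_ratio i j)
      = pair_factor u v * pair_factor u w * pair_factor v w"
    using uvw by (simp add: prod_offdiag_insert pair_factor_def) (simp add: offdiag_def)
  define m\<^sub>1 m\<^sub>2 m\<^sub>3 where "m\<^sub>1 = k * (n\<^sub>0 + 1)" and "m\<^sub>2 = k * (n\<^sub>0 + 2)" and "m\<^sub>3 = k * (n\<^sub>0 + 3)"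
  \<comment> \<open>In terms of \<open>n = n\<^sub>0 + 3\<close> these numbers are \<open>k (n - 2)\<close>, \<open>k (n - 1)\<close>, \<open>k n\<close>; the middle one is \<open>K\<close>.\<close>
  have K: "K = of_nat m\<^sub>2"
    unfolding K_def m\<^sub>2_def by (simp add: n algebra_simps)
  have conv: "1 + of_nat x + of_nat m\<^sub>2 = (of_nat (Suc (x + m\<^sub>2)) :: rat)"
    "2 + of_nat x + of_nat m\<^sub>2 = (of_nat (Suc (Suc (x + m\<^sub>2))) :: rat)"
    "of_nat (Suc (x + m\<^sub>2)) - of_nat k = (of_nat (Suc (x + m\<^sub>1)) :: rat)"
    "of_nat a + of_nat b + of_nat m\<^sub>2 - of_nat k + 1 = (of_nat (Suc (a + b + m\<^sub>1)) :: rat)"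
    "of_nat m\<^sub>2 + 1 = (of_nat (Suc m\<^sub>2) :: rat)"
    "of_nat a + of_nat b + of_nat m\<^sub>2 + 1 = (of_nat (Suc (a + b + m\<^sub>2)) :: rat)"
    "of_nat a + of_nat b + of_nat m\<^sub>2 + 2 = (of_nat (Suc (Suc (a + b + m\<^sub>2))) :: rat)"
    "of_nat m\<^sub>2 + of_nat k + 1 = (of_nat (Suc m\<^sub>3) :: rat)"
    "of_nat m\<^sub>2 + of_nat k + 2 = (of_nat (Suc (Suc m\<^sub>3)) :: rat)" for x
    by (simp_all add: m\<^sub>1_def m\<^sub>2_def m\<^sub>3_def algebra_simps)
  let ?E = "moment a b k {1..n} (pair_factor u v * pair_factor u w * pair_factor v w)"
  have E: "of_nat (Suc (a + m\<^sub>2)) * of_nat (Suc (Suc (a + m\<^sub>2))) * of_nat (Suc (a + m\<^sub>1))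
      * of_nat (Suc (b + m\<^sub>2)) * of_nat (Suc (Suc (b + m\<^sub>2))) * of_nat (Suc (b + m\<^sub>1)) * ?E
    = 6 * (M n a b k * (of_nat (Suc (a + b + m\<^sub>1)) * of_nat (Suc m\<^sub>2) * of_nat (Suc (a + b + m\<^sub>2))
        * of_nat (Suc (Suc (a + b + m\<^sub>2))) * of_nat (Suc m\<^sub>3) * of_nat (Suc (Suc m\<^sub>3))))"
  proof -
    have "mom a b 0 0 0 = M n a b k"
      using morris_constant_term[of "{1..n}" a b k] unfolding mom_def moment_def by simp
    then show ?thesis
      using heavy_triple_average[of a b] by (simp only: K conv)
  qed
  have M: "M n a b k = M n\<^sub>0 a b k
      * (fact (a + b + k * n\<^sub>0) * fact m\<^sub>1 / (fact (a + k * n\<^sub>0) * fact (b + k * n\<^sub>0) * fact k))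
      * (fact (a + b + m\<^sub>1) * fact m\<^sub>2 / (fact (a + m\<^sub>1) * fact (b + m\<^sub>1) * fact k))
      * (fact (a + b + m\<^sub>2) * fact m\<^sub>3 / (fact (a + m\<^sub>2) * fact (b + m\<^sub>2) * fact k))"
    by (simp add: M_def n eval_nat_numeral m\<^sub>1_def m\<^sub>2_def m\<^sub>3_def)
  have prod: "(\<Prod>j<n\<^sub>1. of_nat (j + 1) * fact ((k + 1) * j + a + b + k * n\<^sub>0) * fact (k * j + k + j + k * n\<^sub>0)
                  / (fact k * fact ((k + 1) * j + a + k * n\<^sub>0) * fact ((k + 1) * j + b + k * n\<^sub>0)))
     = (fact (a + b + k * n\<^sub>0) * fact m\<^sub>1 / (fact (a + k * n\<^sub>0) * fact (b + k * n\<^sub>0) * fact k))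
      * (2 * fact (Suc (a + b + m\<^sub>1)) * fact (Suc m\<^sub>2) / (fact (Suc (a + m\<^sub>1)) * fact (Suc (b + m\<^sub>1)) * fact k))
      * (3 * fact (Suc (Suc (a + b + m\<^sub>2))) * fact (Suc (Suc m\<^sub>3))
         / (fact (Suc (Suc (a + m\<^sub>2))) * fact (Suc (Suc (b + m\<^sub>2))) * fact k) :: rat)"
  proof -
    have three: "(\<Prod>j<n\<^sub>1. f j) = f 0 * f 1 * f 2" for f :: "nat \<Rightarrow> rat"
      by (simp add: assms(1) eval_nat_numeral)
    have args: "(k + 1) * 0 + a + b + k * n\<^sub>0 = a + b + k * n\<^sub>0" "(k + 1) * 0 + x + k * n\<^sub>0 = x + k * n\<^sub>0"
      "k * 0 + k + 0 + k * n\<^sub>0 = m\<^sub>1"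
      "(k + 1) * 1 + a + b + k * n\<^sub>0 = Suc (a + b + m\<^sub>1)" "(k + 1) * 1 + x + k * n\<^sub>0 = Suc (x + m\<^sub>1)"
      "k * 1 + k + 1 + k * n\<^sub>0 = Suc m\<^sub>2"
      "(k + 1) * 2 + a + b + k * n\<^sub>0 = Suc (Suc (a + b + m\<^sub>2))"
      "(k + 1) * 2 + x + k * n\<^sub>0 = Suc (Suc (x + m\<^sub>2))"
      "k * 2 + k + 2 + k * n\<^sub>0 = Suc (Suc m\<^sub>3)" for x
      by (simp_all add: m\<^sub>1_def m\<^sub>2_def m\<^sub>3_def algebra_simps)
    show ?thesis
      unfolding three args by (simp add: mult_ac del: fact_Suc)
  qed
  have "?E = M n\<^sub>0 a b k * (\<Prod>j<n\<^sub>1. of_nat (j + 1) * fact ((k + 1) * j + a + b + k * n\<^sub>0) * fact (k * j + k + j + k * n\<^sub>0)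
                  / (fact k * fact ((k + 1) * j + a + k * n\<^sub>0) * fact ((k + 1) * j + b + k * n\<^sub>0)))"
    unfolding prod fact_Suc by (rule cancel_denominators[OF E[unfolded M]]) simp_all
  then show ?thesis
    unfolding heavy moment_def weight_def end_factor_def by (simp only: mult.assoc)
qed

end
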